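(* Let the true density $g_0$ belong to $\mathcal{G}^*$, let $J=J_n$ be deterministic with $1\ll J^d\ll n$, and suppose that $a_0\le \alpha_{\boldsymbol{j}}\le a_1$ for all $\boldsymbol{j}\in[\mathbf{1}:\boldsymbol{J}]$ and some constants $a_0,a_1>0$ (not depending on $n$). Put $\epsilon_n=\max\{J^{-1},\sqrt{J^d/n}\}$. Then for any $M_n\to\infty$, $$\mathrm{E}_0\,\Pi\big(\|g^{*}-g_0\|_1>M_n\epsilon_n\,\big|\,\mathbb{D}_n\big)\to 0 .$$ The optimal rate (over the choice of $J$) $\epsilon_n\asymp n^{-1/(2+d)}$ is achieved by choosing $J\asymp n^{1/(2+d)}$.
   Context: Data: $\mathbb{D}_n=(\boldsymbol{X}_1,\dots,\boldsymbol{X}_n)$ are i.i.d. from a probability density on $[0,1]^d$; $g_0$ is the true density, $\mathrm{P}_0,\mathrm{E}_0$ denote probability and expectation under $g_0$. Write $\boldsymbol{x}\succeq\boldsymbol{y}$ iff $x_k\ge y_k$ for all $k$. $\mathcal{G}^*$ is the set of $g:[0,1]^d\to[0,\infty)$ with $\int g=1$ and $g(\boldsymbol{x})\le g(\boldsymbol{y})$ whenever $\boldsymbol{x}\succeq\boldsymbol{y}$. $\|\cdot\|_1$ is the $\mathbb{L}_1$-norm on $[0,1]^d$. $a_n\ll b_n$ means $a_n/b_n\to0$; $\asymp$ means equality in order. Prior and unrestricted posterior: $\mathbf 1$ is the all-one vector, $\boldsymbol{J}=(J,\dots,J)$, $[\mathbf 1:\boldsymbol J]=\{\boldsymbol j\in\mathbb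 Z_{>0}^d:1\le j_k\le J \text{ for all }k\}$; $I_{\mathbf 1}=[0,1/J]^d$ and $I_{\boldsymbol j}=\prod_{k=1}^d((j_k-1)/J,j_k/J]$ for $\boldsymbol j\ne\mathbf 1$. The random density is $g=J^d\sum_{\boldsymbol j\in[\mathbf 1:\boldsymbol J]}\theta_{\boldsymbol j}\mathbb 1_{I_{\boldsymbol j}}$ with prior $(\theta_{\boldsymbol j})\sim\mathrm{Dir}(J^d;(\alpha_{\boldsymbol j}))$, $\alpha_{\boldsymbol j}>0$. The posterior $\Pi(\cdot|\mathbb D_n)$ is $(\theta_{\boldsymbol j})|\mathbb D_n\sim\mathrm{Dir}(J^d;(\alpha_{\boldsymbol j}+N_{\boldsymbol j}))$, $N_{\boldsymbol j}=\sum_{i=1}^n\mathbb 1_{I_{\boldsymbol j}}(\boldsymbol X_i)$. Immersion posterior: let $\mathcal C_{\boldsymbol J}=\{(c_{\boldsymbol j}):c_{\boldsymbol j_1}\le c_{\boldsymbol j_2}\text{ if }\boldsymbol j_1\succeq\boldsymbol j_2\}$ and let $\tilde{\boldsymbol\theta}$ be any minimizer of $\sum_{\boldsymbol j}|c_{\boldsymbol j}-\theta_{\boldsymbol j}|$ over $(c_{\boldsymbol j})\in\mathcal C_{\boldsymbol J}$ (equivalently $\tilde g=J^d\sum_{\boldsymbol j}\tilde\theta_{\boldsymbol j}\mathbb 1_{I_{\boldsymbol j}}$ is an $\mathbb L_1$-projection of $g$ onto the coordinatewise nonincreasing functions). Then $\theta^*_{\boldsymbol j}=\tilde\theta_{\boldsymbol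 j}/\sum_{\boldsymbol l}\tilde\theta_{\boldsymbol l}$ and $g^*=\tilde g/\int\tilde g=J^d\sum_{\boldsymbol j}\theta^*_{\boldsymbol j}\mathbb 1_{I_{\boldsymbol j}}$; if $\int\tilde g=0$, $g^*$ is set equal to an arbitrary fixed element of $\mathcal G^*$ that is constant on each $I_{\boldsymbol j}$. The notation $\Pi(g^*\in\cdot\,|\mathbb D_n)$ is the law of $g^*$ when $g$ is drawn from the unrestricted posterior. *)

theory Defs
  imports "HOL-Probability.Probability" "HOL-Library.Landau_Symbols"
begin

abbreviation unit_cube :: "(real ^ 'd::finite) set" where
  "unit_cube \<equiv> cbox 0 1"

text \<open>
  The order on \<^typ>\<open>real ^ 'd\<close> and \<^typ>\<open>nat ^ 'd\<close> is the coordinatewise one. Monotone functions of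
  several variables are Lebesgue measurable but not always Borel measurable, hence the Lebesgue
  sigma-algebra here and below.
\<close>

definition monotone_densities :: "(real ^ 'd::finite \<Rightarrow> real) set" where
  "monotone_densities =
     {g. (\<forall>x\<in>unit_cube. 0 \<le> g x)
       \<and> has_bochner_integral (lebesgue_on unit_cube) g 1
       \<and> (\<forall>x\<in>unit_cube. \<forall>y\<in>unit_cube. y \<le> x \<longrightarrow> g x \<le> g y)}"

definition l1_dist :: "(real ^ 'd::finite \<Rightarrow> real) \<Rightarrow> (real ^ 'd \<Rightarrow> real) \<Rightarrow> real" where
  "l1_dist f g = (\<integral>x. \<bar>f x - g x\<bar> \<partial>lebesgue_on unit_cube)"

text \<open>The joint law of \<open>n\<close> independent observations with density \<open>g0\<close> on the cube.\<close>

definition data_law :: "(real ^ 'd::finite \<Rightarrow> real) \<Rightarrow> nat \<Rightarrow> (nat \<Rightarrow> real ^ 'd) measure" where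
  "data_law g0 n = (\<Pi>\<^sub>M i\<in>{..<n}. density (lebesgue_on unit_cube) (\<lambda>x. ennreal (g0 x)))"

definition grid :: "nat \<Rightarrow> (nat ^ 'd::finite) set" where
  "grid J = {j. \<forall>k. 1 \<le> j $ k \<and> j $ k \<le> J}"

definition cell :: "nat \<Rightarrow> nat ^ 'd::finite \<Rightarrow> (real ^ 'd) set" where
  "cell J j =
     (if j = 1 then {x. \<forall>k. 0 \<le> x $ k \<and> x $ k \<le> 1 / real J}
      else {x. \<forall>k. (real (j $ k) - 1) / real J < x $ k \<and> x $ k \<le> real (j $ k) / real J})"

definition histogram :: "nat \<Rightarrow> (nat ^ 'd::finite \<Rightarrow> real) \<Rightarrow> real ^ 'd \<Rightarrow> real" where
  "histogram J \<theta> x = real J ^ CARD('d) * (\<Sum>j\<in>grid J. \<theta> j * indicator (cell J j) x)"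

definition cell_count :: "nat \<Rightarrow> nat \<Rightarrow> (nat \<Rightarrow> real ^ 'd::finite) \<Rightarrow> nat ^ 'd \<Rightarrow> real" where
  "cell_count J n X j = (\<Sum>i<n. indicator (cell J j) (X i))"

text \<open>
  The Dirichlet distribution on the simplex over a finite nonempty index set \<open>I\<close>, given by its
  density with respect to Lebesgue measure in all coordinates but one. The coordinate \<open>i0\<close> that is
  left out is the one determined by the others; the law does not depend on its choice.
  For a singleton \<open>I\<close> the law is the point mass at 1.
\<close>

definition simplex_point :: "'i set \<Rightarrow> 'i \<Rightarrow> ('i \<Rightarrow> real) \<Rightarrow> 'i \<Rightarrow> real" where
  "simplex_point I i0 x = (\<lambda>i\<in>I. if i = i0 then 1 - (\<Sum>k\<in>I - {i0}. x k) else x i)"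

definition dirichlet_density :: "'i set \<Rightarrow> ('i \<Rightarrow> real) \<Rightarrow> ('i \<Rightarrow> real) \<Rightarrow> real" where
  "dirichlet_density I a \<theta> =
     (if \<forall>i\<in>I. 0 < \<theta> i
      then Gamma (\<Sum>i\<in>I. a i) / (\<Prod>i\<in>I. Gamma (a i)) * (\<Prod>i\<in>I. \<theta> i powr (a i - 1))
      else 0)"

definition dirichlet :: "'i set \<Rightarrow> ('i \<Rightarrow> real) \<Rightarrow> ('i \<Rightarrow> real) measure" where
  "dirichlet I a =
     (let i0 = (SOME i. i \<in> I) in
        distr
          (density (\<Pi>\<^sub>M i\<in>I - {i0}. lborel)
             (\<lambda>x. ennreal (dirichlet_density I a (simplex_point I i0 x))))
          (\<Pi>\<^sub>M i\<in>I. borel)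
          (simplex_point I i0))"

text \<open>
  The unrestricted posterior of the cell probabilities, for the prior
  \<open>dirichlet (grid J) \<alpha>\<close> and the observations \<open>X 0, \<dots>, X (n - 1)\<close>.
\<close>

definition posterior ::
  "nat \<Rightarrow> (nat ^ 'd::finite \<Rightarrow> real) \<Rightarrow> nat \<Rightarrow> (nat \<Rightarrow> real ^ 'd) \<Rightarrow> (nat ^ 'd \<Rightarrow> real) measure" where
  "posterior J \<alpha> n X = dirichlet (grid J) (\<lambda>j. \<alpha> j + cell_count J n X j)"

definition monotone_weights :: "nat \<Rightarrow> (nat ^ 'd::finite \<Rightarrow> real) set" where
  "monotone_weights J = {c. \<forall>j1\<in>grid J. \<forall>j2\<in>grid J. j2 \<le> j1 \<longrightarrow> c j1 \<le> c j2}"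

definition is_l1_projection ::
  "nat \<Rightarrow> (nat ^ 'd::finite \<Rightarrow> real) \<Rightarrow> (nat ^ 'd \<Rightarrow> real) \<Rightarrow> bool" where
  "is_l1_projection J \<theta> t \<longleftrightarrow>
     is_arg_min (\<lambda>c. \<Sum>j\<in>grid J. \<bar>c j - \<theta> j\<bar>) (\<lambda>c. c \<in> monotone_weights J) t"

text \<open>
  \<open>T\<close> maps a weight vector to the selected minimizer and \<open>h\<close> is the density used when the projection
  has integral 0.
\<close>

definition immersion ::
  "nat \<Rightarrow> ((nat ^ 'd::finite \<Rightarrow> real) \<Rightarrow> nat ^ 'd \<Rightarrow> real) \<Rightarrow> (real ^ 'd \<Rightarrow> real)
     \<Rightarrow> (nat ^ 'd \<Rightarrow> real) \<Rightarrow> real ^ 'd \<Rightarrow> real" where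
  "immersion J T h \<theta> =
     (let c = (\<integral>x. histogram J (T \<theta>) x \<partial>lebesgue_on unit_cube)
      in if c = 0 then h else (\<lambda>x. histogram J (T \<theta>) x / c))"

text \<open>
  Minimizers need not be unique and \<open>T\<close> is an arbitrary selection, so the event may fail to be
  measurable; it is therefore given its outer probability. When the event is measurable, in
  particular for \<open>L\<^sup>1\<close>-balls and a measurable \<open>T\<close>, this is its ordinary probability under the law of
  the projected density. As a function of the data it is a function of the cell counts, hence
  measurable.
\<close>

definition immersion_posterior ::
  "nat \<Rightarrow> (nat ^ 'd::finite \<Rightarrow> real) \<Rightarrow> ((nat ^ 'd \<Rightarrow> real) \<Rightarrow> nat ^ 'd \<Rightarrow> real)
     \<Rightarrow> (real ^ 'd \<Rightarrow> real) \<Rightarrow> nat \<Rightarrow> (nat \<Rightarrow> real ^ 'd) \<Rightarrow> (real ^ 'd \<Rightarrow> real) set \<Rightarrow> ennreal" where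
  "immersion_posterior J \<alpha> T h n X B =
     outer_measure_of (posterior J \<alpha> n X)
       {\<theta> \<in> space (posterior J \<alpha> n X). immersion J T h \<theta> \<in> B}"

definition admissible_bins :: "nat \<Rightarrow> (nat \<Rightarrow> nat) \<Rightarrow> bool" where
  "admissible_bins d J \<longleftrightarrow>
     (\<forall>n. 1 \<le> J n)
     \<and> (\<lambda>n. 1 / real (J n) ^ d) \<longlonglongrightarrow> 0
     \<and> (\<lambda>n. real (J n) ^ d / real n) \<longlonglongrightarrow> 0"

definition rate :: "nat \<Rightarrow> (nat \<Rightarrow> nat) \<Rightarrow> nat \<Rightarrow> real" where
  "rate d J n = max (1 / real (J n)) (sqrt (real (J n) ^ d / real n))"

end

theory Submission
  imports Defs
begin

text \<open>
  Write \<open>p\<close> for the vector of cell probabilities of the true density \<open>g0\<close>. The argument separates a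
  deterministic inequality from a second moment computation.

  The deterministic part compares everything with the step function that takes on each cell the value
  of \<open>g0\<close> at the upper corner of the cell. Its weights are nonincreasing, so the projection of a weight
  vector \<open>\<theta>\<close> is at most as far from \<open>\<theta>\<close> as they are, and hence at most twice as far from them as \<open>\<theta>\<close> is.
  The step function is within \<open>d * g0 0 / J\<close> of \<open>g0\<close>: the sum over all cells of the difference between
  the values of \<open>g0\<close> at the lower and at the upper corner telescopes to a boundary layer of at most
  \<open>d * J ^ (d - 1)\<close> grid points (\<open>sum_cell_oscillation_le\<close>), and \<open>g0\<close> is bounded by its value at the
  origin. Normalizing a nonnegative function at most doubles its \<open>L\<^sup>1\<close>-distance to a density
  (\<open>l1_dist_normalized\<close>). Together (\<open>l1_dist_immersion_le\<close>),
  the immersed density is within \<open>4 * (\<Sum>j. \<bar>\<theta> j - p j\<bar>) + 6 * d * g0 0 / J\<close> of \<open>g0\<close>.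

  The stochastic part bounds the expected posterior value of \<open>\<Sum>j. (\<theta> j - p j)\<^sup>2\<close> by a constant over \<open>n\<close>.
  The Dirichlet posterior has mean \<open>(\<alpha> j + N j) / (A + n)\<close>, where \<open>A\<close> is the sum of the \<open>\<alpha> j\<close>, and
  variance at most \<open>(\<alpha> j + N j) / (A + n)\<^sup>2\<close>; these moments follow from Dirichlet's integral
  (\<open>dirichlet_mean_square_error\<close>). The counts \<open>N j\<close> are binomial, with variance at most \<open>n * p j\<close>
  (\<open>cell_count_mean_square_error\<close>). The bias caused by the prior is of the same order because
  \<open>p j \<le> g0 0 / J ^ d\<close> and \<open>A \<le> a1 * J ^ d\<close> (\<open>dirichlet_risk_sum_le\<close>).

  By the Cauchy-Schwarz inequality over the \<open>J ^ d\<close> cells, \<open>\<Sum>j. \<bar>\<theta> j - p j\<bar>\<close> is of order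
  \<open>sqrt (J ^ d / n)\<close>, and Markov's inequality bounds the expected posterior probability in question by a
  constant over \<open>M\<^sup>2\<close> as soon as \<open>M\<close> is at least \<open>12 * d * g0 0\<close> (\<open>expected_immersion_posterior_le\<close>).
  The statements about the choice of \<open>J\<close> rest on \<open>(1 / J) ^ d * (J ^ d / n) = 1 / n\<close>: the larger of the
  two error terms is smallest when they balance.
\<close>

section \<open>Dirichlet distributions\<close>

text \<open>
  The substitution \<open>x = t * u\<close> reduces this to Euler's Beta integral.
\<close>

lemma nn_integral_beta_scaled:
  fixes a b t :: real
  assumes "0 < a" "0 < b" "0 < t"
  shows "(\<integral>\<^sup>+x. ennreal (if 0 < x \<and> x < t then x powr (a - 1) * (t - x) powr (b - 1) else 0) \<partial>lborel)
    = ennreal (t powr (a + b - 1) * (Gamma a * Gamma b / Gamma (a + b)))"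
proof -
  let ?f = "\<lambda>x::real. if 0 < x \<and> x < 1 then x powr (a - 1) * (1 - x) powr (b - 1) else 0"
  have "((\<lambda>x. x powr (a - 1) * (1 - x) powr (b - 1)) has_integral Beta a b) {0..1}"
    by (rule has_integral_Beta_real[OF assms(1,2)])
  then have "(?f has_integral Beta a b) {0..1}"
    by (rule has_integral_spike_finite[of "{0, 1}", rotated 2]) auto
  then have "(?f has_integral Beta a b) UNIV"
    by (rule has_integral_on_superset) auto
  then have unit: "(\<integral>\<^sup>+x. ennreal (?f x) \<partial>lborel) = ennreal (Beta a b)"
    by (rule nn_integral_has_integral_lborel[rotated 2]) auto
  have "(\<integral>\<^sup>+x. ennreal (if 0 < x \<and> x < t then x powr (a - 1) * (t - x) powr (b - 1) else 0) \<partial>lborel)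
    = ennreal t * (\<integral>\<^sup>+x. ennreal (if 0 < 0 + t * x \<and> 0 + t * x < t
        then (0 + t * x) powr (a - 1) * (t - (0 + t * x)) powr (b - 1) else 0) \<partial>lborel)"
    using assms by (subst nn_integral_real_affine[where c = t and t = 0]) auto
  also have "\<dots> = ennreal t * (\<integral>\<^sup>+x. ennreal (t powr (a + b - 2)) * ennreal (?f x) \<partial>lborel)"
  proof (intro arg_cong[where f = "\<lambda>u. ennreal t * u"] nn_integral_cong)
    fix x :: real
    have "(t * x) powr (a - 1) * (t - t * x) powr (b - 1)
        = t powr (a + b - 2) * (x powr (a - 1) * (1 - x) powr (b - 1))" if "0 < x" "x < 1"
    proof -
      have "t - t * x = t * (1 - x)" by (simp add: algebra_simps)
      moreover have "t powr (a + b - 2) = t powr (a - 1) * t powr (b - 1)"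
        by (simp flip: powr_add)
      ultimately show ?thesis using that assms by (simp add: powr_mult)
    qed
    then show "ennreal (if 0 < 0 + t * x \<and> 0 + t * x < t
        then (0 + t * x) powr (a - 1) * (t - (0 + t * x)) powr (b - 1) else 0)
        = ennreal (t powr (a + b - 2)) * ennreal (?f x)"
      using assms by (auto simp: ennreal_mult' zero_less_mult_iff)
  qed
  also have "\<dots> = ennreal t * (ennreal (t powr (a + b - 2)) * ennreal (Beta a b))"
    by (subst nn_integral_cmult) (auto simp: unit)
  also have "\<dots> = ennreal (t powr (a + b - 1) * (Gamma a * Gamma b / Gamma (a + b)))"
  proof -
    have "t * t powr (a + b - 2) = t powr (a + b - 1)"
      using assms powr_mult_base[of t "a+b-2"] by simp
    then show ?thesis using assms
      by (simp add: Beta_def mult.assoc flip: ennreal_mult' )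
  qed
  finally show ?thesis .
qed

text \<open>
  Dirichlet's integral. Once the coordinate \<open>y\<close> at \<open>s\<close> is fixed, the other coordinates range over the
  simplex of size \<open>t - y\<close>, where the induction hypothesis applies; what remains is a Beta integral in \<open>y\<close>.
  The size \<open>t\<close> has to be arbitrary for this induction.
\<close>

lemma nn_integral_simplex_monomial:
  fixes a :: "'i \<Rightarrow> real"
  assumes "finite S" and "\<And>i. i \<in> S \<Longrightarrow> 0 < a i" and "0 < b" and "0 < t"
  shows "(\<integral>\<^sup>+x. ennreal (if (\<forall>i\<in>S. 0 < x i) \<and> sum x S < t
            then (\<Prod>i\<in>S. x i powr (a i - 1)) * (t - sum x S) powr (b - 1) else 0)
          \<partial>(\<Pi>\<^sub>M i\<in>S. lborel))
    = ennreal (t powr (sum a S + b - 1) * ((\<Prod>i\<in>S. Gamma (a i)) * Gamma b / Gamma (sum a S + b)))"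
  using assms
proof (induction S arbitrary: t rule: finite_induct)
  case empty
  interpret product_sigma_finite "\<lambda>_::'i. lborel :: real measure"
    by standard
  have "Gamma b \<noteq> 0"
    using Gamma_real_pos[of b] empty by (metis less_irrefl)
  then show ?case using empty
    by (auto simp: PiM_empty nn_integral_count_space_finite)
next
  case (insert s S)
  interpret product_sigma_finite "\<lambda>_::'i. lborel :: real measure"
    by standard
  let ?K = "\<lambda>S t x. if (\<forall>i\<in>S. 0 < x i) \<and> sum x S < t
            then (\<Prod>i\<in>S. x i powr (a i - 1)) * (t - sum x S) powr (b - 1) else 0"
  let ?w = "\<lambda>y. if 0 < y \<and> y < t then y powr (a s - 1) else 0"
  let ?G = "(\<Prod>i\<in>S. Gamma (a i)) * Gamma b / Gamma (sum a S + b)"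
  have apos: "0 < a s" "0 < sum a S + b"
    using insert.prems sum_nonneg[of S a] by (auto intro: add_nonneg_pos less_imp_le)
  have G0: "0 \<le> ?G"
    using apos insert.prems
    by (intro divide_nonneg_nonneg mult_nonneg_nonneg prod_nonneg less_imp_le[OF Gamma_real_pos]) auto
  \<comment> \<open>The bound \<open>y < t\<close> is implied by the constraint on the sum, because all coordinates are positive.\<close>
  have step: "?K (insert s S) t (x(s := y)) = ?w y * ?K S (t - y) x" for x y
  proof -
    have sum: "sum (x(s := y)) (insert s S) = y + sum x S"
      using insert.hyps by (subst sum.insert) (auto intro!: sum.cong)
    have prod: "(\<Prod>i\<in>S. (x(s := y)) i powr (a i - 1)) = (\<Prod>i\<in>S. x i powr (a i - 1))"
      using insert.hyps by (intro prod.cong) auto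
    have all: "(\<forall>i\<in>insert s S. 0 < (x(s := y)) i) \<longleftrightarrow> 0 < y \<and> (\<forall>i\<in>S. 0 < x i)"
      using insert.hyps by auto
    have "y < t" if "y + sum x S < t" "\<forall>i\<in>S. 0 < x i"
      using that sum_nonneg[of S x] by (auto intro: less_imp_le) (smt (verit))
    then show ?thesis
      unfolding sum all using insert.hyps prod
      by (auto simp: algebra_simps)
  qed
  have "(\<integral>\<^sup>+x. ennreal (?K (insert s S) t x) \<partial>(\<Pi>\<^sub>M i\<in>insert s S. lborel))
    = (\<integral>\<^sup>+y. \<integral>\<^sup>+x. ennreal (?K (insert s S) t (x(s := y))) \<partial>(\<Pi>\<^sub>M i\<in>S. lborel) \<partial>lborel)"
    using insert.hyps by (intro product_nn_integral_insert_rev) auto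
  also have "\<dots> = (\<integral>\<^sup>+y. ennreal (?w y) * (\<integral>\<^sup>+x. ennreal (?K S (t - y) x) \<partial>(\<Pi>\<^sub>M i\<in>S. lborel)) \<partial>lborel)"
    using insert.hyps unfolding step
    by (subst nn_integral_cmult[symmetric]) (auto simp: ennreal_mult')
  also have "\<dots> = (\<integral>\<^sup>+y. ennreal ?G * ennreal (if 0 < y \<and> y < t
       then y powr (a s - 1) * (t - y) powr (sum a S + b - 1) else 0) \<partial>lborel)"
  proof (rule nn_integral_cong)
    fix y
    show "ennreal (?w y) * (\<integral>\<^sup>+x. ennreal (?K S (t - y) x) \<partial>(\<Pi>\<^sub>M i\<in>S. lborel))
      = ennreal ?G * ennreal (if 0 < y \<and> y < t
           then y powr (a s - 1) * (t - y) powr (sum a S + b - 1) else 0)"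
    proof (cases "0 < y \<and> y < t")
      case True
      then have "(\<integral>\<^sup>+x. ennreal (?K S (t - y) x) \<partial>(\<Pi>\<^sub>M i\<in>S. lborel))
          = ennreal ((t - y) powr (sum a S + b - 1) * ?G)"
        using insert.prems by (intro insert.IH) auto
      with True show ?thesis
        using G0 by (simp add: mult_ac flip: ennreal_mult')
    qed (simp only: if_False ennreal_0 mult_zero_left mult_zero_right)
  qed
  also have "\<dots> = ennreal ?G * ennreal (t powr (a s + (sum a S + b) - 1)
      * (Gamma (a s) * Gamma (sum a S + b) / Gamma (a s + (sum a S + b))))"
    using apos insert.prems by (subst nn_integral_cmult) (auto simp: nn_integral_beta_scaled)
  also have "\<dots> = ennreal (t powr (sum a (insert s S) + b - 1)
      * ((\<Prod>i\<in>insert s S. Gamma (a i)) * Gamma b / Gamma (sum a (insert s S) + b)))"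
  proof -
    have "Gamma (sum a S + b) \<noteq> 0"
      using apos Gamma_real_pos by (metis less_irrefl)
    then show ?thesis
      using G0 insert.hyps by (simp add: add.assoc mult_ac flip: ennreal_mult')
  qed
  finally show ?case .
qed

lemma sets_dirichlet [measurable_cong]: "sets (dirichlet I a) = sets (\<Pi>\<^sub>M i\<in>I. borel)"
  by (simp add: dirichlet_def Let_def)

lemma measurable_simplex_point:
  assumes "finite I"
  shows "simplex_point I i0 \<in> (\<Pi>\<^sub>M i\<in>I - {i0}. lborel) \<rightarrow>\<^sub>M (\<Pi>\<^sub>M i\<in>I. borel)"
proof -
  have "(\<lambda>x. \<lambda>i\<in>I. if i = i0 then 1 - (\<Sum>k\<in>I - {i0}. x k) else x i :: real)
      \<in> (\<Pi>\<^sub>M i\<in>I - {i0}. lborel) \<rightarrow>\<^sub>M (\<Pi>\<^sub>M i\<in>I. borel)"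
  proof (rule measurable_restrict)
    fix i assume "i \<in> I"
    then show "(\<lambda>x. if i = i0 then 1 - (\<Sum>k\<in>I - {i0}. x k) else x i :: real)
        \<in> borel_measurable (\<Pi>\<^sub>M i\<in>I - {i0}. lborel)"
      by (cases "i = i0") auto
  qed
  then show ?thesis
    by (simp add: simplex_point_def[abs_def])
qed

lemma borel_measurable_dirichlet_density:
  assumes "finite I"
  shows "dirichlet_density I a \<in> borel_measurable (\<Pi>\<^sub>M i\<in>I. borel)"
proof -
  have [measurable]: "Measurable.pred (\<Pi>\<^sub>M i\<in>I. borel) (\<lambda>\<theta>. \<forall>i\<in>I. 0 < (\<theta> i :: real))"
    using assms by (intro pred_intros_finite) auto
  show ?thesis
    unfolding dirichlet_density_def[abs_def] using assms by measurable
qed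

lemma nn_integral_dirichlet:
  fixes f :: "('i \<Rightarrow> real) \<Rightarrow> ennreal"
  assumes "finite I" and "f \<in> borel_measurable (\<Pi>\<^sub>M i\<in>I. borel)"
  defines "i0 \<equiv> SOME i. i \<in> I"
  shows "(\<integral>\<^sup>+\<theta>. f \<theta> \<partial>dirichlet I a)
    = (\<integral>\<^sup>+x. ennreal (dirichlet_density I a (simplex_point I i0 x)) * f (simplex_point I i0 x)
         \<partial>(\<Pi>\<^sub>M i\<in>I - {i0}. lborel))"
proof -
  note [measurable] = measurable_simplex_point[OF assms(1), of i0] assms(2)
    borel_measurable_dirichlet_density[OF assms(1)]
  show ?thesis
    unfolding dirichlet_def Let_def i0_def[symmetric]
    by (simp add: nn_integral_distr nn_integral_density)
qed

lemma AE_dirichlet_positive: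
  assumes "finite I"
  shows "AE \<theta> in dirichlet I a. \<forall>i\<in>I. 0 < \<theta> i"
proof -
  let ?i0 = "SOME i. i \<in> I"
  note [measurable] = measurable_simplex_point[OF assms, of ?i0]
    borel_measurable_dirichlet_density[OF assms]
  have [measurable]: "Measurable.pred (\<Pi>\<^sub>M i\<in>I. borel) (\<lambda>\<theta>. \<forall>i\<in>I. 0 < (\<theta> i :: real))"
    using assms by (intro pred_intros_finite) auto
  show ?thesis
    unfolding dirichlet_def Let_def
    by (subst AE_distr_iff) (auto simp: AE_density dirichlet_density_def)
qed

text \<open>
  In the coordinates of the simplex the density is a multiple of the integrand of Dirichlet's integral
  with \<open>t = 1\<close>, where the parameter of the coordinate that is left out plays the part of \<open>b\<close>.
\<close>

lemma prob_space_dirichlet: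
  assumes I: "finite I" "I \<noteq> {}" and a: "\<And>i. i \<in> I \<Longrightarrow> 0 < a i"
  shows "prob_space (dirichlet I a)"
proof
  define i0 where "i0 = (SOME i. i \<in> I)"
  have i0: "i0 \<in> I"
    using I by (simp add: i0_def some_in_eq)
  let ?S = "I - {i0}"
  let ?C = "Gamma (sum a I) / (\<Prod>i\<in>I. Gamma (a i))"
  let ?K = "\<lambda>x. if (\<forall>i\<in>?S. 0 < x i) \<and> sum x ?S < 1
            then (\<Prod>i\<in>?S. x i powr (a i - 1)) * (1 - sum x ?S) powr (a i0 - 1) else 0"
  have split: "sum a I = sum a ?S + a i0" "(\<Prod>i\<in>I. Gamma (a i)) = (\<Prod>i\<in>?S. Gamma (a i)) * Gamma (a i0)"
    using sum.remove[OF I(1) i0, of a] prod.remove[OF I(1) i0, of "\<lambda>i. Gamma (a i)"]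
    by (simp_all add: mult.commute)
  have A: "0 < sum a I"
    using I a by (intro sum_pos) auto
  have P: "0 < (\<Prod>i\<in>I. Gamma (a i))"
    using a by (intro prod_pos) auto
  have dens: "dirichlet_density I a (simplex_point I i0 x) = ?C * ?K x" for x
  proof -
    have pos: "(\<forall>i\<in>I. 0 < simplex_point I i0 x i) \<longleftrightarrow> (\<forall>i\<in>?S. 0 < x i) \<and> sum x ?S < 1"
      using i0 by (auto simp: simplex_point_def)
    have "(\<Prod>i\<in>I. simplex_point I i0 x i powr (a i - 1))
        = simplex_point I i0 x i0 powr (a i0 - 1) * (\<Prod>i\<in>?S. simplex_point I i0 x i powr (a i - 1))"
      by (rule prod.remove[OF I(1) i0])
    also have "(\<Prod>i\<in>?S. simplex_point I i0 x i powr (a i - 1)) = (\<Prod>i\<in>?S. x i powr (a i - 1))"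
      by (intro prod.cong) (auto simp: simplex_point_def)
    also have "simplex_point I i0 x i0 = 1 - sum x ?S"
      using i0 by (simp add: simplex_point_def)
    finally show ?thesis
      unfolding dirichlet_density_def pos by (simp add: mult.commute)
  qed
  have "emeasure (dirichlet I a) (space (dirichlet I a)) = (\<integral>\<^sup>+\<theta>. 1 \<partial>dirichlet I a)"
    by simp
  also have "\<dots> = (\<integral>\<^sup>+x. ennreal ?C * ennreal (?K x) \<partial>(\<Pi>\<^sub>M i\<in>?S. lborel))"
    using I A P by (subst nn_integral_dirichlet)
       (simp_all add: dens i0_def[symmetric] less_imp_le Gamma_real_pos flip: ennreal_mult')
  also have "\<dots> = ennreal ?C * (\<integral>\<^sup>+x. ennreal (?K x) \<partial>(\<Pi>\<^sub>M i\<in>?S. lborel))"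
    using I by (intro nn_integral_cmult) auto
  also have "\<dots> = ennreal ?C * ennreal ((\<Prod>i\<in>?S. Gamma (a i)) * Gamma (a i0) / Gamma (sum a ?S + a i0))"
    using I a i0 by (subst nn_integral_simplex_monomial) auto
  also have "\<dots> = 1"
    unfolding split[symmetric] using A P
    by (simp add: Gamma_real_pos less_imp_le less_imp_neq[symmetric] flip: ennreal_mult)
  finally show "emeasure (dirichlet I a) (space (dirichlet I a)) = 1" .
qed

text \<open>
  Multiplying the density by \<open>\<theta> j\<close> raises the exponent of \<open>\<theta> j\<close> by one, and the normalizing constants
  differ by the factor \<open>a j / sum a I\<close> because \<open>Gamma (z + 1) = z * Gamma z\<close>. Iterating this gives all
  mixed moments.
\<close>

lemma nn_integral_dirichlet_size_biased:
  fixes f :: "('i \<Rightarrow> real) \<Rightarrow> ennreal"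
  assumes I: "finite I" and a: "\<And>i. i \<in> I \<Longrightarrow> 0 < a i" and j: "j \<in> I"
    and f: "f \<in> borel_measurable (\<Pi>\<^sub>M i\<in>I. borel)"
  shows "(\<integral>\<^sup>+\<theta>. ennreal (\<theta> j) * f \<theta> \<partial>dirichlet I a)
    = ennreal (a j / sum a I) * (\<integral>\<^sup>+\<theta>. f \<theta> \<partial>dirichlet I (a(j := a j + 1)))"
proof -
  let ?a = "a(j := a j + 1)" and ?i0 = "SOME i. i \<in> I"
  note [measurable] = measurable_simplex_point[OF I, of ?i0] f
    borel_measurable_dirichlet_density[OF I]
  have A: "0 < sum a I"
    using I a j by (intro sum_pos) auto
  have P: "0 < (\<Prod>i\<in>I. Gamma (a i))"
    using a by (intro prod_pos) auto
  have sumP: "sum ?a I = sum a I + 1"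
    using sum.remove[OF I j, of a] sum.remove[OF I j, of ?a] by simp
  have prodP: "(\<Prod>i\<in>I. Gamma (?a i)) = a j * (\<Prod>i\<in>I. Gamma (a i))"
    using prod.remove[OF I j, of "\<lambda>i. Gamma (a i)"] prod.remove[OF I j, of "\<lambda>i. Gamma (?a i)"]
      Gamma_plus1[of "a j"] a[OF j] by (auto simp: nonpos_Ints_def mult.assoc)
  have shift: "dirichlet_density I a \<theta> * \<theta> j = a j / sum a I * dirichlet_density I ?a \<theta>" for \<theta>
  proof (cases "\<forall>i\<in>I. 0 < \<theta> i")
    case True
    have "(\<Prod>i\<in>I. \<theta> i powr (?a i - 1)) = (\<Prod>i\<in>I. \<theta> i powr (a i - 1)) * \<theta> j"
    proof -
      have "\<theta> j powr (a j) = \<theta> j * \<theta> j powr (a j - 1)"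
        using powr_mult_base[of "\<theta> j" "a j - 1"] True j by (simp add: less_imp_le)
      then show ?thesis
        using prod.remove[OF I j, of "\<lambda>i. \<theta> i powr (a i - 1)"]
          prod.remove[OF I j, of "\<lambda>i. \<theta> i powr (?a i - 1)"] by simp
    qed
    moreover have "Gamma (sum ?a I) = sum a I * Gamma (sum a I)"
      unfolding sumP using A by (intro Gamma_plus1) (auto elim!: nonpos_Ints_cases)
    ultimately show ?thesis
      using True A a[OF j] unfolding dirichlet_density_def prodP by simp
  next
    case False
    then have "dirichlet_density I b \<theta> = 0" for b
      by (auto simp: dirichlet_density_def)
    then show ?thesis by simp
  qed
  have "(\<integral>\<^sup>+\<theta>. ennreal (\<theta> j) * f \<theta> \<partial>dirichlet I a)
    = (\<integral>\<^sup>+x. ennreal (dirichlet_density I a (simplex_point I ?i0 x))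
         * (ennreal (simplex_point I ?i0 x j) * f (simplex_point I ?i0 x))
         \<partial>(\<Pi>\<^sub>M i\<in>I - {?i0}. lborel))"
    using j by (intro nn_integral_dirichlet I) measurable
  also have "\<dots> = (\<integral>\<^sup>+x. ennreal (a j / sum a I) *
      (ennreal (dirichlet_density I ?a (simplex_point I ?i0 x)) * f (simplex_point I ?i0 x))
         \<partial>(\<Pi>\<^sub>M i\<in>I - {?i0}. lborel))"
  proof (rule nn_integral_cong)
    fix x
    let ?p = "simplex_point I ?i0 x"
    have nonneg: "0 \<le> dirichlet_density I a ?p"
      using A P Gamma_real_pos[OF A]
      by (auto simp: dirichlet_density_def less_imp_le a Gamma_real_pos
          intro!: divide_nonneg_nonneg mult_nonneg_nonneg prod_nonneg)
    have "ennreal (dirichlet_density I a ?p) * ennreal (?p j)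
        = ennreal (a j / sum a I) * ennreal (dirichlet_density I ?a ?p)"
      using shift[of ?p] nonneg A a[OF j] by (simp flip: ennreal_mult')
    then show "ennreal (dirichlet_density I a ?p) * (ennreal (?p j) * f ?p)
        = ennreal (a j / sum a I) * (ennreal (dirichlet_density I ?a ?p) * f ?p)"
      by (simp add: mult.assoc[symmetric])
  qed
  also have "\<dots> = ennreal (a j / sum a I) * (\<integral>\<^sup>+\<theta>. f \<theta> \<partial>dirichlet I ?a)"
    using I f by (subst nn_integral_cmult) (auto simp: nn_integral_dirichlet)
  finally show ?thesis .
qed

lemma dirichlet_moments:
  assumes I: "finite I" and a: "\<And>i. i \<in> I \<Longrightarrow> 0 < a i" and j: "j \<in> I"
  shows has_bochner_integral_dirichlet_mean:
      "has_bochner_integral (dirichlet I a) (\<lambda>\<theta>. \<theta> j) (a j / sum a I)"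
    and has_bochner_integral_dirichlet_square:
      "has_bochner_integral (dirichlet I a) (\<lambda>\<theta>. (\<theta> j)\<^sup>2)
         (a j * (a j + 1) / (sum a I * (sum a I + 1)))"
proof -
  let ?a = "a(j := a j + 1)"
  have A: "0 < sum a I"
    using I a j by (intro sum_pos) auto
  have sumP: "sum ?a I = sum a I + 1"
    using sum.remove[OF I j, of a] sum.remove[OF I j, of ?a] by simp
  have meas [measurable]: "(\<lambda>\<theta>. \<theta> j) \<in> borel_measurable (\<Pi>\<^sub>M i\<in>I. borel)"
    using j by measurable
  have pos: "AE \<theta> in dirichlet I a. 0 \<le> \<theta> j"
    using AE_dirichlet_positive[OF I, of a] by eventually_elim (use j in \<open>auto intro: less_imp_le\<close>)
  have mean: "(\<integral>\<^sup>+\<theta>. ennreal (\<theta> j) \<partial>dirichlet I b) = ennreal (b j / sum b I)"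
    if b: "\<And>i. i \<in> I \<Longrightarrow> 0 < b i" for b
  proof -
    interpret prob_space "dirichlet I (b(j := b j + 1))"
      using I j b by (intro prob_space_dirichlet) (auto intro: add_pos_pos)
    show ?thesis
      using nn_integral_dirichlet_size_biased[OF I b j, where f = "\<lambda>_. 1"] by (simp add: emeasure_space_1)
  qed
  show "has_bochner_integral (dirichlet I a) (\<lambda>\<theta>. \<theta> j) (a j / sum a I)"
    using A a[OF j] by (intro has_bochner_integral_nn_integral pos mean a) auto
  have "(\<integral>\<^sup>+\<theta>. ennreal ((\<theta> j)\<^sup>2) \<partial>dirichlet I a) = (\<integral>\<^sup>+\<theta>. ennreal (\<theta> j) * ennreal (\<theta> j) \<partial>dirichlet I a)"
    using pos by (intro nn_integral_cong_AE) (auto simp: power2_eq_square ennreal_mult')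
  also have "\<dots> = ennreal (a j / sum a I) * (\<integral>\<^sup>+\<theta>. ennreal (\<theta> j) \<partial>dirichlet I ?a)"
    by (intro nn_integral_dirichlet_size_biased I a j) auto
  also have "(\<integral>\<^sup>+\<theta>. ennreal (\<theta> j) \<partial>dirichlet I ?a) = ennreal ((a j + 1) / (sum a I + 1))"
    using a by (subst mean) (auto simp: sumP[simplified] intro: add_pos_pos)
  also have "ennreal (a j / sum a I) * ennreal ((a j + 1) / (sum a I + 1))
      = ennreal (a j * (a j + 1) / (sum a I * (sum a I + 1)))"
    using A a[OF j] by (simp flip: ennreal_mult)
  finally show "has_bochner_integral (dirichlet I a) (\<lambda>\<theta>. (\<theta> j)\<^sup>2)
         (a j * (a j + 1) / (sum a I * (sum a I + 1)))"
    using A a[OF j] by (intro has_bochner_integral_nn_integral) auto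
qed

text \<open>
  Squared bias plus variance, where the variance \<open>a j * (A - a j) / (A\<^sup>2 * (A + 1))\<close> with \<open>A = sum a I\<close>
  is at most \<open>a j / A\<^sup>2\<close>.
\<close>

lemma dirichlet_mean_square_error:
  assumes I: "finite I" and a: "\<And>i. i \<in> I \<Longrightarrow> 0 < a i" and j: "j \<in> I"
  shows "(\<integral>\<^sup>+\<theta>. ennreal ((\<theta> j - p)\<^sup>2) \<partial>dirichlet I a)
    \<le> ennreal ((a j / sum a I - p)\<^sup>2 + a j / (sum a I)\<^sup>2)"
proof -
  let ?A = "sum a I"
  interpret prob_space "dirichlet I a"
    using I j a by (intro prob_space_dirichlet) auto
  have A: "0 < ?A"
    using I a j by (intro sum_pos) auto
  have le: "a j \<le> ?A"
    using I a j by (intro member_le_sum) (auto intro: less_imp_le)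
  have "has_bochner_integral (dirichlet I a) (\<lambda>\<theta>. (\<theta> j)\<^sup>2 - 2 * p * \<theta> j + p\<^sup>2)
      (a j * (a j + 1) / (?A * (?A + 1)) - 2 * p * (a j / ?A) + p\<^sup>2)"
    using has_bochner_integral_dirichlet_mean[OF I a j] has_bochner_integral_dirichlet_square[OF I a j]
      has_bochner_integral_iff[of "dirichlet I a" "\<lambda>_. p\<^sup>2" "p\<^sup>2"]
    by (intro has_bochner_integral_add has_bochner_integral_diff has_bochner_integral_mult_right)
       (auto simp: prob_space)
  then have hb: "has_bochner_integral (dirichlet I a) (\<lambda>\<theta>. (\<theta> j - p)\<^sup>2)
      (a j * (a j + 1) / (?A * (?A + 1)) - 2 * p * (a j / ?A) + p\<^sup>2)"
    by (simp add: power2_diff algebra_simps)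
  have "(\<integral>\<^sup>+\<theta>. ennreal ((\<theta> j - p)\<^sup>2) \<partial>dirichlet I a)
      = ennreal (a j * (a j + 1) / (?A * (?A + 1)) - 2 * p * (a j / ?A) + p\<^sup>2)"
    using hb by (subst nn_integral_eq_integral) (auto simp: has_bochner_integral_iff)
  also have "\<dots> \<le> ennreal ((a j / ?A - p)\<^sup>2 + a j / ?A\<^sup>2)"
  proof (rule ennreal_leI)
    have "(a j + 1) / (?A + 1) \<le> (a j + 1) / ?A"
      using A a[OF j] by (intro divide_left_mono) auto
    then have "a j / ?A * ((a j + 1) / (?A + 1)) \<le> a j / ?A * ((a j + 1) / ?A)"
      using A a[OF j] by (intro mult_left_mono) auto
    also have "\<dots> = (a j / ?A)\<^sup>2 + a j / ?A\<^sup>2"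
      by (simp add: power2_eq_square ring_distribs add_divide_distrib)
    finally have "a j * (a j + 1) / (?A * (?A + 1)) \<le> (a j / ?A)\<^sup>2 + a j / ?A\<^sup>2"
      by simp
    then show "a j * (a j + 1) / (?A * (?A + 1)) - 2 * p * (a j / ?A) + p\<^sup>2
        \<le> (a j / ?A - p)\<^sup>2 + a j / ?A\<^sup>2"
      unfolding power2_diff by (simp add: mult_ac)
  qed
  finally show ?thesis .
qed

section \<open>Cells and histograms\<close>

abbreviation cube_measure :: "(real ^ 'd::finite) measure" where
  "cube_measure \<equiv> lebesgue_on unit_cube"

definition grid_point :: "nat \<Rightarrow> nat ^ 'd::finite \<Rightarrow> real ^ 'd" where
  "grid_point J j = (\<chi> k. real (j $ k) / real J)"

definition lower_neighbour :: "nat ^ 'd::finite \<Rightarrow> nat ^ 'd" where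
  "lower_neighbour j = (\<chi> k. j $ k - 1)"

lemma box_eq_vimage: "{j :: 'a ^ 'd::finite. \<forall>k. j $ k \<in> S} = vec_lambda ` (\<Pi>\<^sub>E k\<in>UNIV. S)"
proof -
  have "j \<in> vec_lambda ` (\<Pi>\<^sub>E k\<in>UNIV. S)" if "\<forall>k. j $ k \<in> S" for j :: "'a ^ 'd"
    using that by (intro image_eqI[of _ _ "vec_nth j"]) auto
  then show ?thesis by auto
qed

lemma card_box_nat: "finite S \<Longrightarrow> card {j :: 'a ^ 'd::finite. \<forall>k. j $ k \<in> S} = card S ^ CARD('d)"
  unfolding box_eq_vimage by (subst card_image) (auto simp: card_PiE inj_on_def vec_lambda_inject)

lemma grid_eq: "grid J = {j :: nat ^ 'd::finite. \<forall>k. j $ k \<in> {1..J}}"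
  by (auto simp: grid_def)

lemma finite_grid [simp]: "finite (grid J)"
  unfolding grid_eq box_eq_vimage by (intro finite_imageI finite_PiE) auto

lemma card_grid: "card (grid J :: (nat ^ 'd::finite) set) = J ^ CARD('d)"
  unfolding grid_eq by (subst card_box_nat) auto

lemma one_in_grid: "1 \<le> J \<Longrightarrow> 1 \<in> grid J"
  by (simp add: grid_def)

lemma cell_borel [measurable]: "cell J j \<in> sets borel"
proof -
  have "cell J j = (if j = 1 then {x \<in> space borel. \<forall>k\<in>UNIV. 0 \<le> x $ k \<and> x $ k \<le> 1 / real J}
      else {x \<in> space borel. \<forall>k\<in>UNIV. (real (j $ k) - 1) / real J < x $ k \<and> x $ k \<le> real (j $ k) / real J})"
    by (simp add: cell_def)
  also have "\<dots> \<in> sets borel"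
  proof -
    have [measurable]: "(\<lambda>x :: real ^ 'a. x $ k) \<in> borel_measurable borel" for k
      by (intro borel_measurable_continuous_onI continuous_intros)
    show ?thesis
      by (cases "j = 1") auto
  qed
  finally show ?thesis .
qed

lemma cell_subset_cbox:
  assumes "j \<in> grid J"
  shows "cell J j \<subseteq> cbox (grid_point J (lower_neighbour j)) (grid_point J j)"
proof
  fix x assume x: "x \<in> cell J j"
  have "(real (j $ k) - 1) / real J \<le> x $ k \<and> x $ k \<le> real (j $ k) / real J" for k
    using x by (cases "j = 1") (auto simp: cell_def intro: less_imp_le)
  then show "x \<in> cbox (grid_point J (lower_neighbour j)) (grid_point J j)"
    using assms by (auto simp: grid_def grid_point_def lower_neighbour_def mem_box_cart of_nat_diff)
qed

lemma box_subset_cell: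
  assumes "j \<in> grid J"
  shows "box (grid_point J (lower_neighbour j)) (grid_point J j) \<subseteq> cell J j"
  using assms
  by (auto simp: cell_def grid_def grid_point_def lower_neighbour_def mem_box_cart of_nat_diff
      intro: less_imp_le split: if_splits)

lemma grid_point_in_cube:
  assumes "1 \<le> J" "\<And>k. j $ k \<le> J"
  shows "grid_point J j \<in> unit_cube"
  using assms by (auto simp: grid_point_def mem_box_cart divide_simps)

lemma lower_neighbour_le: "j \<in> grid J \<Longrightarrow> lower_neighbour j $ k \<le> J"
  by (auto simp: lower_neighbour_def grid_def intro: le_trans[OF diff_le_self])

lemma cell_subset_cube:
  assumes "1 \<le> J" "j \<in> grid J"
  shows "cell J j \<subseteq> unit_cube"
proof -
  have "grid_point J (lower_neighbour j) \<in> unit_cube" "grid_point J j \<in> unit_cube"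
    using assms lower_neighbour_le[OF assms(2)]
    by (auto intro!: grid_point_in_cube simp: grid_def)
  then show ?thesis
    using cell_subset_cbox[OF assms(2)] by (simp add: mem_box_cart subset_iff) (meson order_trans)
qed

text \<open>
  A cell contains the open box and is contained in the closed box with the same corners, and these two
  have the same volume.
\<close>

lemma emeasure_cell:
  assumes J: "1 \<le> J" and j: "j \<in> grid J"
  shows "emeasure lborel (cell J j :: (real ^ 'd::finite) set) = ennreal ((1 / real J) ^ CARD('d))"
proof -
  let ?l = "grid_point J (lower_neighbour j)" and ?u = "grid_point J j"
  have side: "(?u - ?l) \<bullet> b = 1 / real J" if "b \<in> Basis" for b
  proof -
    from that obtain k where "b = axis k 1"
      by (auto simp: Basis_vec_def)
    then show ?thesis
      using j by (auto simp: inner_axis grid_point_def lower_neighbour_def grid_def of_nat_diff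
          diff_divide_distrib[symmetric])
  qed
  then have le: "?l \<bullet> b \<le> ?u \<bullet> b" if "b \<in> Basis" for b
    using that by (simp add: inner_diff_left) (metis diff_ge_0_iff_ge of_nat_0_le_iff zero_le_divide_1_iff)
  have "emeasure lborel (box ?l ?u) = ennreal ((1 / real J) ^ CARD('d))"
    by (subst emeasure_lborel_box[OF le]) (simp_all add: side)
  moreover have "emeasure lborel (cbox ?l ?u) = ennreal ((1 / real J) ^ CARD('d))"
    by (subst emeasure_lborel_cbox[OF le]) (simp_all add: side)
  moreover have "emeasure lborel (box ?l ?u) \<le> emeasure lborel (cell J j)"
    using box_subset_cell[OF j] by (intro emeasure_mono) auto
  moreover have "emeasure lborel (cell J j) \<le> emeasure lborel (cbox ?l ?u)"
    using cell_subset_cbox[OF j] by (intro emeasure_mono) auto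
  ultimately show ?thesis
    by simp
qed

lemma cell_in_cube_sets [measurable]:
  assumes "1 \<le> J" "j \<in> grid J"
  shows "cell J j \<in> sets cube_measure"
  using cell_subset_cube[OF assms] by (auto simp: sets_restrict_space image_iff intro!: bexI[of _ "cell J j"])

lemma measure_cube_cell:
  assumes J: "1 \<le> J" and j: "j \<in> grid J"
  shows "emeasure cube_measure (cell J j :: (real ^ 'd::finite) set) = ennreal ((1 / real J) ^ CARD('d))"
  using cell_subset_cube[OF assms] emeasure_cell[OF assms]
  by (subst emeasure_restrict_space) auto

text \<open>
  Cells other than the first one are half-open, so rounding up \<open>J * x $ k\<close> recovers their index. The cell
  at the origin is closed and could only meet cells with an index above 1 in some coordinate, which
  start strictly beyond \<open>1 / J\<close>.
\<close>

lemma cell_disjoint: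
  assumes J: "1 \<le> J" and j: "j \<in> grid J" "j' \<in> grid J" and x: "x \<in> cell J j" "x \<in> cell J j'"
  shows "j = j'"
proof -
  have one: "i = 1" if i: "i \<in> grid J" "x \<in> cell J i" and x1: "x \<in> cell J 1" for i
  proof (rule ccontr)
    assume "i \<noteq> 1"
    then obtain k where k: "i $ k \<noteq> 1"
      by (auto simp: vec_eq_iff)
    have "(real (i $ k) - 1) / real J < x $ k" "x $ k \<le> 1 / real J" "1 \<le> i $ k"
      using i x1 \<open>i \<noteq> 1\<close> by (auto simp: cell_def grid_def)
    then have "(real (i $ k) - 1) / real J < 1 / real J" by linarith
    then show False
      using J k \<open>1 \<le> i $ k\<close> by (simp add: divide_less_cancel)
  qed
  show ?thesis
  proof (cases "j = 1 \<or> j' = 1")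
    case True
    then show ?thesis
      using one[OF j(1) x(1)] one[OF j(2) x(2)] x by auto
  next
    case False
    have "j $ k = j' $ k" for k
    proof -
      have "(real (j $ k) - 1) / real J < real (j' $ k) / real J"
        "(real (j' $ k) - 1) / real J < real (j $ k) / real J"
        using False x by (auto simp: cell_def intro: less_le_trans)
      then show ?thesis
        using J by (auto simp: divide_less_cancel)
    qed
    then show ?thesis by (simp add: vec_eq_iff)
  qed
qed

lemma cells_cover:
  fixes x :: "real ^ 'd::finite"
  assumes J: "1 \<le> J" and x: "\<And>k. 0 < x $ k" "\<And>k. x $ k \<le> 1"
  shows "\<exists>j\<in>grid J. x \<in> cell J j"
proof
  let ?j = "\<chi> k. nat \<lceil>real J * x $ k\<rceil>"
  have pos: "0 < \<lceil>real J * x $ k\<rceil>" for k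
    using J x(1)[of k] by simp
  have le: "\<lceil>real J * x $ k\<rceil> \<le> int J" for k
    using J x(2)[of k] by (simp add: ceiling_le_iff mult_left_le)
  show "?j \<in> grid J"
    using pos le by (auto simp: grid_def Suc_le_eq nat_le_iff)
  have bounds: "(real (?j $ k) - 1) / real J < x $ k" "x $ k \<le> real (?j $ k) / real J" for k
    using J pos[of k] by (simp_all add: field_simps) linarith+
  show "x \<in> cell J ?j"
  proof (cases "?j = 1")
    case True
    then have "?j $ k = 1" for k by (simp only: one_index)
    then have "x $ k \<le> 1 / real J" for k
      using bounds(2)[of k] by simp
    then show ?thesis
      unfolding True using x(1) by (simp add: cell_def less_imp_le)
  next
    case False
    then show ?thesis
      using bounds by (simp add: cell_def)
  qed
qed

text \<open>
  In dimension two and above, a point with a zero coordinate lies in no cell unless all its coordinates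
  are at most \<open>1 / J\<close>. The points with a zero coordinate lie on finitely many hyperplanes.
\<close>

lemma AE_in_cell:
  assumes J: "1 \<le> J"
  shows "AE x in cube_measure. \<exists>j\<in>grid J. (x :: real ^ 'd::finite) \<in> cell J j"
proof -
  have "AE x :: real ^ 'd in lebesgue. x $ k \<noteq> 0" for k
    using negligible_standard_hyperplane_cart[of k]
    by (intro AE_I'[where N = "{x. x $ k = 0}"]) (auto simp: negligible_iff_null_sets)
  then have "AE x :: real ^ 'd in lebesgue. \<forall>k. x $ k \<noteq> 0"
    by (simp add: AE_all_countable)
  then have "AE x :: real ^ 'd in lebesgue. x \<in> unit_cube \<longrightarrow> (\<exists>j\<in>grid J. x \<in> cell J j)"
  proof eventually_elim
    case (elim x)
    then show ?case
      using cells_cover[OF J, of x] by (auto simp: mem_box_cart less_le)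
  qed
  then show ?thesis
    by (subst AE_restrict_space_iff) auto
qed

lemma sum_cell_indicator:
  fixes f :: "nat ^ 'd::finite \<Rightarrow> real"
  assumes "1 \<le> J" "j \<in> grid J" "x \<in> cell J j"
  shows "(\<Sum>i\<in>grid J. f i * indicator (cell J i) x) = f j"
proof -
  have "(\<Sum>i\<in>grid J. f i * indicator (cell J i) x) = (\<Sum>i\<in>grid J. if i = j then f i else 0)"
  proof (rule sum.cong[OF refl])
    fix i :: "nat ^ 'd" assume "i \<in> grid J"
    then have "x \<in> cell J i \<longleftrightarrow> i = j"
      using cell_disjoint[OF assms(1) _ assms(2) _ assms(3)] assms(3) by blast
    then show "f i * indicator (cell J i) x = (if i = j then f i else 0)"
      by (simp add: indicator_def)
  qed
  then show ?thesis using assms(2) by simp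
qed

lemma histogram_on_cell:
  fixes \<theta> :: "nat ^ 'd::finite \<Rightarrow> real"
  assumes "1 \<le> J" "j \<in> grid J" "x \<in> cell J j"
  shows "histogram J \<theta> x = real J ^ CARD('d) * \<theta> j"
  unfolding histogram_def using sum_cell_indicator[OF assms] by simp

lemma integrable_cell:
  fixes c :: real
  assumes "1 \<le> J" "j \<in> grid J"
  shows "integrable cube_measure (\<lambda>x. c * indicator (cell J j) x)"
  using assms by (intro integrable_mult_right integrable_real_indicator) (auto simp: measure_cube_cell)

lemma integral_cell:
  fixes c :: real and j :: "nat ^ 'd::finite"
  assumes "1 \<le> J" "j \<in> grid J"
  shows "(\<integral>x. c * indicator (cell J j) x \<partial>cube_measure) = c * (1 / real J) ^ CARD('d)"
proof -
  have "cell J j \<inter> unit_cube = cell J j"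
    using cell_subset_cube[OF assms] by blast
  then show ?thesis
    using measure_cube_cell[OF assms] by (simp add: measure_def)
qed

lemma integrable_histogram:
  assumes "1 \<le> J"
  shows "integrable cube_measure (histogram J \<theta>)"
  unfolding histogram_def[abs_def]
  by (intro integrable_mult_right Bochner_Integration.integrable_sum integrable_cell assms)

lemma integral_over_cells:
  fixes f :: "real ^ 'd::finite \<Rightarrow> real"
  assumes J: "1 \<le> J" and f: "integrable cube_measure f"
  shows "(\<integral>x. f x \<partial>cube_measure) = (\<Sum>j\<in>grid J. \<integral>x. f x * indicator (cell J j) x \<partial>cube_measure)"
proof -
  have int: "integrable cube_measure (\<lambda>x. f x * indicator (cell J j) x)" if "j \<in> grid J" for j
    using f J that by (intro integrable_real_mult_indicator) auto
  then have "(\<Sum>j\<in>grid J. \<integral>x. f x * indicator (cell J j) x \<partial>cube_measure)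
      = (\<integral>x. (\<Sum>j\<in>grid J. f x * indicator (cell J j) x) \<partial>cube_measure)"
    by (intro Bochner_Integration.integral_sum[symmetric])
  also have "\<dots> = (\<integral>x. f x \<partial>cube_measure)"
  proof (rule integral_cong_AE)
    show "AE x in cube_measure. (\<Sum>j\<in>grid J. f x * indicator (cell J j) x) = f x"
      using AE_in_cell[OF J]
    proof eventually_elim
      case (elim x)
      then obtain i where i: "i \<in> grid J" "x \<in> cell J i" by auto
      then show ?case
        using sum_cell_indicator[OF J i, of "\<lambda>_. f x"] by simp
    qed
  qed (use f int in \<open>simp_all only: borel_measurable_sum borel_measurable_integrable\<close>)
  finally show ?thesis by simp
qed

lemma integral_histogram:
  fixes \<theta> :: "nat ^ 'd::finite \<Rightarrow> real"
  assumes J: "1 \<le> J"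
  shows "(\<integral>x. histogram J \<theta> x \<partial>cube_measure) = sum \<theta> (grid J)"
proof -
  have "(\<integral>x. histogram J \<theta> x * indicator (cell J j) x \<partial>cube_measure) = \<theta> j" if j: "j \<in> grid J" for j
  proof -
    have "histogram J \<theta> x * indicator (cell J j) x = real J ^ CARD('d) * \<theta> j * indicator (cell J j) x" for x
      using histogram_on_cell[OF J j, of x \<theta>] by (auto simp: indicator_def)
    then show ?thesis
      using J by (simp only: integral_cell[OF J j]) (simp add: power_divide)
  qed
  then show ?thesis
    unfolding integral_over_cells[OF J integrable_histogram[OF J]] by simp
qed

lemma l1_dist_histograms:
  fixes \<theta> \<eta> :: "nat ^ 'd::finite \<Rightarrow> real"
  assumes J: "1 \<le> J"
  shows "l1_dist (histogram J \<theta>) (histogram J \<eta>) = (\<Sum>j\<in>grid J. \<bar>\<theta> j - \<eta> j\<bar>)"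
proof -
  have "l1_dist (histogram J \<theta>) (histogram J \<eta>)
      = (\<integral>x. histogram J (\<lambda>j. \<bar>\<theta> j - \<eta> j\<bar>) x \<partial>cube_measure)"
    unfolding l1_dist_def
  proof (rule integral_cong_AE)
    show "AE x in cube_measure. \<bar>histogram J \<theta> x - histogram J \<eta> x\<bar> = histogram J (\<lambda>j. \<bar>\<theta> j - \<eta> j\<bar>) x"
      using AE_in_cell[OF J]
      by eventually_elim
         (auto simp: histogram_on_cell[OF J] abs_mult simp flip: right_diff_distrib)
  qed (simp_all only: borel_measurable_abs borel_measurable_diff borel_measurable_integrable[OF integrable_histogram[OF J]])
  then show ?thesis by (simp add: integral_histogram[OF J])
qed

section \<open>Monotone densities, projection and normalization\<close>

lemma monotone_densitiesD:
  assumes "g \<in> monotone_densities"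
  shows "x \<in> unit_cube \<Longrightarrow> 0 \<le> g x"
    and "integrable cube_measure g" and "(\<integral>x. g x \<partial>cube_measure) = 1"
    and "x \<in> unit_cube \<Longrightarrow> y \<in> unit_cube \<Longrightarrow> (\<And>k. y $ k \<le> x $ k) \<Longrightarrow> g x \<le> g y"
  using assms by (auto simp: monotone_densities_def has_bochner_integral_iff less_eq_vec_def)

lemma monotone_density_le_origin:
  assumes "g \<in> monotone_densities" "x \<in> unit_cube"
  shows "g x \<le> g 0"
  using assms(2) by (intro monotone_densitiesD(4)[OF assms]) (auto simp: mem_box_cart)

definition cell_prob :: "(real ^ 'd::finite \<Rightarrow> real) \<Rightarrow> nat \<Rightarrow> nat ^ 'd \<Rightarrow> real" where
  "cell_prob g J j = (\<integral>x. g x * indicator (cell J j) x \<partial>cube_measure)"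

text \<open>
  For a nonincreasing function this bounds the oscillation over the cell.
\<close>

definition cell_oscillation :: "(real ^ 'd::finite \<Rightarrow> real) \<Rightarrow> nat \<Rightarrow> nat ^ 'd \<Rightarrow> real" where
  "cell_oscillation g J j = g (grid_point J (lower_neighbour j)) - g (grid_point J j)"

text \<open>
  The cell weights of the step function that agrees with \<open>g\<close> at the upper corner of each cell. Evaluation
  at a corner makes them inherit the monotonicity of \<open>g\<close>.
\<close>

definition corner_weights :: "(real ^ 'd::finite \<Rightarrow> real) \<Rightarrow> nat \<Rightarrow> nat ^ 'd \<Rightarrow> real" where
  "corner_weights g J j = g (grid_point J j) * (1 / real J) ^ CARD('d)"

text \<open>
  The lower corners form the box \<open>{0..J - 1}\<close> and the upper corners the box \<open>{1..J}\<close> in each coordinate.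
  In the difference of the two sums everything cancels but the points of the first box that have a zero
  coordinate. There are \<open>J ^ d - (J - 1) ^ d\<close> of them, at most \<open>d * J ^ (d - 1)\<close> by Bernoulli's inequality.
\<close>

lemma sum_cell_oscillation_le:
  fixes g :: "real ^ 'd::finite \<Rightarrow> real"
  assumes g: "g \<in> monotone_densities" and J: "1 \<le> J"
  shows "(\<Sum>j\<in>grid J. cell_oscillation g J j) * (1 / real J) ^ CARD('d) \<le> real CARD('d) * g 0 / real J"
proof -
  let ?f = "\<lambda>j :: nat ^ 'd. g (grid_point J j)"
  let ?G = "grid J :: (nat ^ 'd) set" and ?L = "{j :: nat ^ 'd. \<forall>k. j $ k \<in> {..<J}}"
  have finL: "finite ?L"
    unfolding box_eq_vimage by (intro finite_imageI finite_PiE) auto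
  have f_nonneg: "0 \<le> ?f j" and f_le: "?f j \<le> g 0" if "\<And>k. j $ k \<le> J" for j
    using grid_point_in_cube[OF J that] monotone_densitiesD(1)[OF g] monotone_density_le_origin[OF g]
    by auto
  have low: "j $ k - Suc 0 < J" if "\<forall>k. 0 < j $ k \<and> j $ k \<le> J" for j :: "nat ^ 'd" and k
    using that[rule_format, of k] by linarith
  have shift: "(\<Sum>j\<in>?G. ?f (lower_neighbour j)) = (\<Sum>j\<in>?L. ?f j)"
    by (rule sum.reindex_bij_witness[of _ "\<lambda>j. \<chi> k. j $ k + 1" lower_neighbour])
       (auto simp: lower_neighbour_def grid_def vec_eq_iff Suc_le_eq less_imp_le low)
  have "?L \<inter> ?G = grid (J - 1)"
  proof -
    have "m \<le> J - 1 \<longleftrightarrow> m < J" for m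
      using J by linarith
    then show ?thesis
      by (auto simp: grid_def intro: less_imp_le)
  qed
  moreover have "card ?L = J ^ CARD('d)"
    by (subst card_box_nat) auto
  ultimately have cardD: "card (?L - ?G) = J ^ CARD('d) - (J - 1) ^ CARD('d)"
    by (simp only: card_Diff_subset_Int finite_grid finite_Int simp_thms card_grid)
  have "(\<Sum>j\<in>?G. cell_oscillation g J j) = (\<Sum>j\<in>?L. ?f j) - (\<Sum>j\<in>?G. ?f j)"
    by (simp add: cell_oscillation_def sum_subtractf shift)
  also have "\<dots> = (\<Sum>j\<in>?L - ?G. ?f j) - (\<Sum>j\<in>?G - ?L. ?f j)"
    using finL sum.Int_Diff[of ?L ?f ?G] sum.Int_Diff[of ?G ?f ?L] by (simp add: Int_commute)
  also have "\<dots> \<le> (\<Sum>j\<in>?L - ?G. g 0)"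
  proof -
    have "0 \<le> (\<Sum>j\<in>?G - ?L. ?f j)"
      by (intro sum_nonneg f_nonneg) (auto simp: grid_def)
    moreover have "(\<Sum>j\<in>?L - ?G. ?f j) \<le> (\<Sum>j\<in>?L - ?G. g 0)"
      by (intro sum_mono f_le) (auto intro: less_imp_le)
    ultimately show ?thesis by linarith
  qed
  also have "\<dots> = g 0 * (real J ^ CARD('d) - (real J - 1) ^ CARD('d))"
    unfolding sum_constant cardD using J by (simp add: of_nat_diff power_mono)
  finally have "(\<Sum>j\<in>?G. cell_oscillation g J j) * (1 / real J) ^ CARD('d)
      \<le> g 0 * (real J ^ CARD('d) - (real J - 1) ^ CARD('d)) * (1 / real J) ^ CARD('d)"
    by (intro mult_right_mono) auto
  also have "\<dots> = g 0 * (1 - (1 + (- 1 / real J)) ^ CARD('d))"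
  proof -
    have "1 + (- 1 / real J) = (real J - 1) * (1 / real J)"
      using J by (simp add: field_simps)
    then have "(1 + (- 1 / real J)) ^ CARD('d) = (real J - 1) ^ CARD('d) * (1 / real J) ^ CARD('d)"
      by (simp only: power_mult_distrib)
    moreover have "real J ^ CARD('d) * (1 / real J) ^ CARD('d) = 1"
      using J by (simp add: power_divide)
    ultimately show ?thesis by (simp add: algebra_simps)
  qed
  also have "\<dots> \<le> g 0 * (real CARD('d) / real J)"
  proof (rule mult_left_mono)
    have "1 + real CARD('d) * (- 1 / real J) \<le> (1 + (- 1 / real J)) ^ CARD('d)"
      using J by (intro Bernoulli_inequality) simp
    then show "1 - (1 + (- 1 / real J)) ^ CARD('d) \<le> real CARD('d) / real J" by simp
    show "0 \<le> g 0"
      by (intro monotone_densitiesD(1)[OF g]) (simp add: mem_box_cart)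
  qed
  finally show ?thesis by (simp add: mult.commute)
qed

lemma monotone_density_on_cell:
  assumes g: "g \<in> monotone_densities" and J: "1 \<le> J" and j: "j \<in> grid J" and x: "x \<in> cell J j"
  shows "g (grid_point J j) \<le> g x" "g x \<le> g (grid_point J (lower_neighbour j))"
proof -
  have "grid_point J (lower_neighbour j) \<in> unit_cube" "grid_point J j \<in> unit_cube"
    using J j lower_neighbour_le[OF j]
    by (auto intro!: grid_point_in_cube simp: grid_def)
  then show "g (grid_point J j) \<le> g x" "g x \<le> g (grid_point J (lower_neighbour j))"
    using cell_subset_cbox[OF j] cell_subset_cube[OF J j] x
    by (auto intro!: monotone_densitiesD(4)[OF g] simp: mem_box_cart subset_iff)
qed

lemma integrable_on_cell:
  assumes "g \<in> monotone_densities" "1 \<le> J" "j \<in> grid J"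
  shows "integrable cube_measure (\<lambda>x. g x * indicator (cell J j) x)"
  using assms monotone_densitiesD(2) by (intro integrable_real_mult_indicator) auto

lemma cell_prob_nonneg:
  assumes "g \<in> monotone_densities"
  shows "0 \<le> cell_prob g J j"
  unfolding cell_prob_def using monotone_densitiesD(1)[OF assms]
  by (intro integral_nonneg_AE AE_I2) auto

lemma sum_cell_prob:
  assumes "g \<in> monotone_densities" "1 \<le> J"
  shows "(\<Sum>j\<in>grid J. cell_prob g J j) = 1"
  using integral_over_cells[OF assms(2) monotone_densitiesD(2)[OF assms(1)]]
    monotone_densitiesD(3)[OF assms(1)] by (simp add: cell_prob_def)

lemma cell_prob_bounds:
  fixes g :: "real ^ 'd::finite \<Rightarrow> real"
  assumes g: "g \<in> monotone_densities" and J: "1 \<le> J" and j: "j \<in> grid J"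
  shows "corner_weights g J j \<le> cell_prob g J j"
    and "cell_prob g J j \<le> g (grid_point J (lower_neighbour j)) * (1 / real J) ^ CARD('d)"
proof -
  note bounds = monotone_density_on_cell[OF g J j]
  have "(\<integral>x. g (grid_point J j) * indicator (cell J j) x \<partial>cube_measure) \<le> cell_prob g J j"
    unfolding cell_prob_def
    by (intro integral_mono integrable_cell integrable_on_cell assms) (auto simp: indicator_def bounds)
  then show "corner_weights g J j \<le> cell_prob g J j"
    by (simp only: integral_cell[OF J j] corner_weights_def)
  have "cell_prob g J j \<le>
      (\<integral>x. g (grid_point J (lower_neighbour j)) * indicator (cell J j) x \<partial>cube_measure)"
    unfolding cell_prob_def
    by (intro integral_mono integrable_cell integrable_on_cell assms) (auto simp: indicator_def bounds)
  then show "cell_prob g J j \<le> g (grid_point J (lower_neighbour j)) * (1 / real J) ^ CARD('d)"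
    by (simp only: integral_cell[OF J j])
qed

lemma cell_prob_le:
  fixes g :: "real ^ 'd::finite \<Rightarrow> real"
  assumes g: "g \<in> monotone_densities" and J: "1 \<le> J" and j: "j \<in> grid J"
  shows "cell_prob g J j \<le> g 0 / real J ^ CARD('d)"
proof -
  have "g (grid_point J (lower_neighbour j)) \<le> g 0"
    using lower_neighbour_le[OF j] by (intro monotone_density_le_origin[OF g] grid_point_in_cube J)
  then have "g (grid_point J (lower_neighbour j)) * (1 / real J) ^ CARD('d) \<le> g 0 * (1 / real J) ^ CARD('d)"
    by (intro mult_right_mono) auto
  with cell_prob_bounds(2)[OF assms] show ?thesis
    by (simp add: power_divide)
qed

lemma sum_cell_prob_corner_dist:
  fixes g :: "real ^ 'd::finite \<Rightarrow> real"
  assumes g: "g \<in> monotone_densities" and J: "1 \<le> J"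
  shows "(\<Sum>j\<in>grid J. \<bar>cell_prob g J j - corner_weights g J j\<bar>) \<le> real CARD('d) * g 0 / real J"
proof -
  have "(\<Sum>j\<in>grid J. \<bar>cell_prob g J j - corner_weights g J j\<bar>)
      \<le> (\<Sum>j\<in>grid J. cell_oscillation g J j * (1 / real J) ^ CARD('d))"
  proof (rule sum_mono)
    fix j :: "nat ^ 'd" assume j: "j \<in> grid J"
    show "\<bar>cell_prob g J j - corner_weights g J j\<bar> \<le> cell_oscillation g J j * (1 / real J) ^ CARD('d)"
      using cell_prob_bounds[OF g J j]
      by (simp add: cell_oscillation_def corner_weights_def algebra_simps)
  qed
  also have "\<dots> \<le> real CARD('d) * g 0 / real J"
    using sum_cell_oscillation_le[OF assms] by (simp add: sum_distrib_right)
  finally show ?thesis .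
qed

lemma l1_dist_corner_histogram:
  fixes g :: "real ^ 'd::finite \<Rightarrow> real"
  assumes g: "g \<in> monotone_densities" and J: "1 \<le> J"
  shows "l1_dist (histogram J (corner_weights g J)) g \<le> real CARD('d) * g 0 / real J"
proof -
  let ?H = "histogram J (corner_weights g J)"
  have int: "integrable cube_measure (\<lambda>x. \<bar>?H x - g x\<bar>)"
    by (intro integrable_abs Bochner_Integration.integrable_diff integrable_histogram J
        monotone_densitiesD(2)[OF g])
  have "l1_dist ?H g = (\<Sum>j\<in>grid J. \<integral>x. \<bar>?H x - g x\<bar> * indicator (cell J j) x \<partial>cube_measure)"
    unfolding l1_dist_def by (rule integral_over_cells[OF J int])
  also have "\<dots> \<le> (\<Sum>j\<in>grid J. cell_oscillation g J j * (1 / real J) ^ CARD('d))"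
  proof (rule sum_mono)
    fix j :: "nat ^ 'd" assume j: "j \<in> grid J"
    have "(\<integral>x. \<bar>?H x - g x\<bar> * indicator (cell J j) x \<partial>cube_measure)
        \<le> (\<integral>x. cell_oscillation g J j * indicator (cell J j) x \<partial>cube_measure)"
    proof (intro integral_mono integrable_cell J j)
      show "integrable cube_measure (\<lambda>x. \<bar>?H x - g x\<bar> * indicator (cell J j) x)"
        using J j int by (intro integrable_real_mult_indicator) auto
      show "\<bar>?H x - g x\<bar> * indicator (cell J j) x \<le> cell_oscillation g J j * indicator (cell J j) x" for x
      proof (cases "x \<in> cell J j")
        case True
        have "?H x = g (grid_point J j)"
          using J by (simp add: histogram_on_cell[OF J j True] corner_weights_def power_divide)
        then show ?thesis
          using monotone_density_on_cell[OF g J j True] True by (simp add: cell_oscillation_def)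
      qed simp
    qed
    also have "\<dots> = cell_oscillation g J j * (1 / real J) ^ CARD('d)"
      by (rule integral_cell[OF J j])
    finally show "(\<integral>x. \<bar>?H x - g x\<bar> * indicator (cell J j) x \<partial>cube_measure)
        \<le> cell_oscillation g J j * (1 / real J) ^ CARD('d)" .
  qed
  also have "\<dots> \<le> real CARD('d) * g 0 / real J"
    using sum_cell_oscillation_le[OF assms] by (simp add: sum_distrib_right)
  finally show ?thesis .
qed

lemma corner_weights_monotone:
  assumes g: "g \<in> monotone_densities" and J: "1 \<le> J"
  shows "corner_weights g J \<in> monotone_weights J"
  unfolding monotone_weights_def corner_weights_def
proof (intro CollectI ballI impI mult_right_mono)
  fix j1 j2 :: "nat ^ 'a" assume j: "j1 \<in> grid J" "j2 \<in> grid J" "j2 \<le> j1"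
  then show "g (grid_point J j1) \<le> g (grid_point J j2)"
    using J by (intro monotone_densitiesD(4)[OF g] grid_point_in_cube)
      (auto simp: grid_def less_eq_vec_def grid_point_def divide_right_mono)
qed simp

text \<open>
  Otherwise replacing the negative entries by 0 would preserve monotonicity and bring the vector strictly
  closer to \<open>\<theta>\<close>.
\<close>

lemma l1_projection_nonneg:
  fixes \<theta> :: "nat ^ 'd::finite \<Rightarrow> real"
  assumes t: "is_l1_projection J \<theta> t" and \<theta>: "\<And>j. j \<in> grid J \<Longrightarrow> 0 \<le> \<theta> j" and j: "j \<in> grid J"
  shows "0 \<le> t j"
proof (rule ccontr)
  assume neg: "\<not> 0 \<le> t j"
  let ?t = "\<lambda>i. max 0 (t i)"
  have "t \<in> monotone_weights J"
    using t by (simp add: is_l1_projection_def is_arg_min_def)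
  then have "?t \<in> monotone_weights J"
    by (force simp: monotone_weights_def)
  moreover have "(\<Sum>i\<in>grid J. \<bar>?t i - \<theta> i\<bar>) < (\<Sum>i\<in>grid J. \<bar>t i - \<theta> i\<bar>)"
  proof (rule sum_strict_mono_ex1)
    show "\<forall>i\<in>grid J. \<bar>?t i - \<theta> i\<bar> \<le> \<bar>t i - \<theta> i\<bar>"
    proof
      fix i :: "nat ^ 'd" assume "i \<in> grid J"
      then show "\<bar>?t i - \<theta> i\<bar> \<le> \<bar>t i - \<theta> i\<bar>" using \<theta>[of i] by auto
    qed
    show "\<exists>i\<in>grid J. \<bar>?t i - \<theta> i\<bar> < \<bar>t i - \<theta> i\<bar>"
      using j \<theta>[OF j] neg by (intro bexI[of _ j]) auto
  qed simp
  ultimately show False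
    using t by (auto simp: is_l1_projection_def is_arg_min_def)
qed

lemma l1_dist_triangle:
  assumes "integrable cube_measure f" "integrable cube_measure g" "integrable cube_measure h"
  shows "l1_dist f h \<le> l1_dist f g + l1_dist g h"
proof -
  have "l1_dist f h \<le> (\<integral>x. \<bar>f x - g x\<bar> + \<bar>g x - h x\<bar> \<partial>cube_measure)"
    unfolding l1_dist_def using assms
    by (intro integral_mono Bochner_Integration.integrable_add integrable_abs
        Bochner_Integration.integrable_diff) auto
  also have "\<dots> = l1_dist f g + l1_dist g h"
    unfolding l1_dist_def using assms
    by (intro Bochner_Integration.integral_add integrable_abs Bochner_Integration.integrable_diff)
  finally show ?thesis .
qed

text \<open>
  Both \<open>\<bar>c - 1\<bar>\<close> and the distance between \<open>f\<close> and \<open>f / c\<close>, which equals \<open>\<bar>c - 1\<bar>\<close> for nonnegative \<open>f\<close>,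
  are at most the distance of \<open>f\<close> to \<open>g\<close>. If \<open>c = 0\<close> this distance is at least 1, while two densities are
  never further apart than 2.
\<close>

lemma l1_dist_normalized:
  assumes f: "integrable cube_measure f" "\<And>x. 0 \<le> f x"
    and g: "g \<in> monotone_densities" and h: "h \<in> monotone_densities"
  defines "c \<equiv> \<integral>x. f x \<partial>cube_measure"
  shows "l1_dist (if c = 0 then h else (\<lambda>x. f x / c)) g \<le> 2 * l1_dist f g"
proof -
  note gI = monotone_densitiesD(2,3)[OF g] and hI = monotone_densitiesD(2,3)[OF h]
  have c0: "0 \<le> c"
    unfolding c_def using f(2) by (intro integral_nonneg_AE) auto
  have "\<bar>c - 1\<bar> = \<bar>\<integral>x. f x - g x \<partial>cube_measure\<bar>"
    using f(1) gI by (simp add: c_def)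
  also have "\<dots> \<le> l1_dist f g"
    unfolding l1_dist_def by (rule integral_abs_bound)
  finally have dist: "\<bar>c - 1\<bar> \<le> l1_dist f g" .
  show ?thesis
  proof (cases "c = 0")
    case True
    have "l1_dist h g \<le> (\<integral>x. h x + g x \<partial>cube_measure)"
      unfolding l1_dist_def
    proof (intro integral_mono)
      fix x assume "x \<in> space (cube_measure :: (real ^ 'a) measure)"
      then have "x \<in> unit_cube" by simp
      then show "\<bar>h x - g x\<bar> \<le> h x + g x"
        using monotone_densitiesD(1)[OF g, of x] monotone_densitiesD(1)[OF h, of x] by auto
    qed (use gI hI in auto)
    also have "\<dots> = 2" using gI hI by simp
    finally show ?thesis using True dist by simp
  next
    case False
    with c0 have c: "0 < c" by simp
    have "l1_dist (\<lambda>x. f x / c) f = (\<integral>x. \<bar>1 / c - 1\<bar> * f x \<partial>cube_measure)"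
      unfolding l1_dist_def
    proof (intro Bochner_Integration.integral_cong refl)
      fix x
      have "f x / c - f x = (1 / c - 1) * f x" by (simp add: algebra_simps)
      then show "\<bar>f x / c - f x\<bar> = \<bar>1 / c - 1\<bar> * f x"
        using f(2)[of x] by (simp add: abs_mult)
    qed
    also have "\<dots> = \<bar>1 / c - 1\<bar> * c" by (simp add: c_def)
    also have "\<dots> = \<bar>(1 / c - 1) * c\<bar>" using c by (simp add: abs_mult)
    also have "\<dots> = \<bar>c - 1\<bar>" using c by (simp add: algebra_simps abs_minus_commute)
    finally have "l1_dist (\<lambda>x. f x / c) f = \<bar>c - 1\<bar>" .
    moreover have "l1_dist (\<lambda>x. f x / c) g \<le> l1_dist (\<lambda>x. f x / c) f + l1_dist f g"
      using f(1) gI(1) by (intro l1_dist_triangle) auto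
    ultimately show ?thesis using False dist by simp
  qed
qed

text \<open>
  The constants: normalization gives a factor 2, and so does replacing \<open>\<theta>\<close> by its projection. The
  distance between \<open>p\<close> and the corner weights therefore enters four times, and the distance between \<open>g0\<close>
  and its corner histogram twice; both are at most \<open>d * g0 0 / J\<close>.
\<close>

lemma l1_dist_immersion_le:
  fixes g0 :: "real ^ 'd::finite \<Rightarrow> real" and \<theta> :: "nat ^ 'd \<Rightarrow> real"
  assumes g0: "g0 \<in> monotone_densities" and h: "h \<in> monotone_densities" and J: "1 \<le> J"
    and T: "is_l1_projection J \<theta> (T \<theta>)" and \<theta>: "\<And>j. j \<in> grid J \<Longrightarrow> 0 \<le> \<theta> j"
  shows "l1_dist (immersion J T h \<theta>) g0
    \<le> 4 * (\<Sum>j\<in>grid J. \<bar>\<theta> j - cell_prob g0 J j\<bar>) + 6 * real CARD('d) * g0 0 / real J"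
proof -
  let ?c = "corner_weights g0 J" and ?p = "cell_prob g0 J"
  define b where "b = real CARD('d) * g0 0 / real J"
  have six: "6 * real CARD('d) * g0 0 / real J = 6 * b"
    by (simp add: b_def)
  let ?D = "\<lambda>u v. \<Sum>j\<in>grid J. \<bar>u j - v j :: real\<bar>"
  have tri: "?D u w \<le> ?D u v + ?D v w" for u v w
    unfolding sum.distrib[symmetric] by (intro sum_mono) auto
  \<comment> \<open>The corner weights are a competitor in the minimization that defines the projection.\<close>
  have minimal: "?D (T \<theta>) \<theta> \<le> ?D ?c \<theta>"
    using T corner_weights_monotone[OF g0 J]
    unfolding is_l1_projection_def is_arg_min_def by (meson not_le)
  have "?D (T \<theta>) ?c \<le> 2 * ?D \<theta> ?c"
    using tri[of "T \<theta>" ?c \<theta>] minimal by (simp add: abs_minus_commute)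
  also have "\<dots> \<le> 2 * (?D \<theta> ?p + b)"
    using order_trans[OF tri[of \<theta> ?c ?p] add_left_mono[OF sum_cell_prob_corner_dist[OF g0 J]]]
    unfolding b_def by (rule mult_left_mono) simp
  finally have proj: "?D (T \<theta>) ?c \<le> 2 * ?D \<theta> ?p + 2 * b" by simp
  have nonneg: "0 \<le> histogram J (T \<theta>) x" for x
    unfolding histogram_def using l1_projection_nonneg[OF T \<theta>]
    by (intro mult_nonneg_nonneg sum_nonneg) auto
  have "l1_dist (immersion J T h \<theta>) g0 \<le> 2 * l1_dist (histogram J (T \<theta>)) g0"
    unfolding immersion_def Let_def
    using l1_dist_normalized[OF integrable_histogram[OF J] nonneg g0 h] .
  moreover have "l1_dist (histogram J (T \<theta>)) g0
      \<le> l1_dist (histogram J (T \<theta>)) (histogram J ?c) + l1_dist (histogram J ?c) g0"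
    by (intro l1_dist_triangle integrable_histogram J monotone_densitiesD(2)[OF g0])
  ultimately show ?thesis
    using proj l1_dist_corner_histogram[OF g0 J, folded b_def]
    unfolding l1_dist_histograms[OF J] six by linarith
qed

section \<open>Independent observations and cell counts\<close>

text \<open>
  The variance of a sum of independent centred variables. Every product \<open>Y (X i) * Y (X l)\<close> is a product
  over all coordinates, with trivial factors at the coordinates other than \<open>i\<close> and \<open>l\<close>, so its integral
  factorizes and vanishes for \<open>i \<noteq> l\<close>.
\<close>

lemma (in prob_space) expectation_square_sum_PiM:
  fixes Y :: "'a \<Rightarrow> real"
  assumes Y: "integrable M Y" "expectation Y = 0" and Y2: "integrable M (\<lambda>x. (Y x)\<^sup>2)"
  shows "has_bochner_integral (\<Pi>\<^sub>M i\<in>{..<n::nat}. M) (\<lambda>X. (\<Sum>i<n. Y (X i))\<^sup>2)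
    (real n * expectation (\<lambda>x. (Y x)\<^sup>2))"
proof -
  interpret product_sigma_finite "\<lambda>_::nat. M"
    by standard
  let ?v = "expectation (\<lambda>x. (Y x)\<^sup>2)"
  let ?f = "\<lambda>i l k x. (if k = i then Y x else 1) * (if k = l then Y x else 1)"
  have f_int: "integrable M (?f i l k)" for i l k
    using Y Y2 by (cases "k = i"; cases "k = l") (auto simp: power2_eq_square)
  have cov: "has_bochner_integral (\<Pi>\<^sub>M i\<in>{..<n}. M) (\<lambda>X. Y (X i) * Y (X l)) (if i = l then ?v else 0)"
    if "i < n" "l < n" for i l
  proof -
    have factors: "Y (X i) * Y (X l) = (\<Prod>k<n. ?f i l k (X k))" for X
      using that by (simp add: prod.distrib prod.delta)
    have "(\<Prod>k<n. expectation (?f i l k)) = (if i = l then ?v else 0)"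
    proof (cases "i = l")
      case True
      have "expectation (?f i l k) = (if k = i then ?v else 1)" for k
        using True by (simp add: power2_eq_square prob_space)
      then show ?thesis using True that by simp
    next
      case False
      then have "expectation (?f i l i) = 0" using Y by simp
      then show ?thesis
        using False that by (auto simp del: if_split intro!: prod_zero bexI[of _ i])
    qed
    then show ?thesis
      unfolding has_bochner_integral_iff factors
      using product_integrable_prod[of "{..<n}" "?f i l", OF finite_lessThan f_int]
        product_integral_prod[of "{..<n}" "?f i l", OF finite_lessThan f_int] by (simp only: simp_thms)
  qed
  have "has_bochner_integral (\<Pi>\<^sub>M i\<in>{..<n}. M) (\<lambda>X. \<Sum>i<n. \<Sum>l<n. Y (X i) * Y (X l))
      (\<Sum>i<n. \<Sum>l<n. if i = l then ?v else 0)"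
    by (intro has_bochner_integral_sum cov) auto
  then show ?thesis
    by (simp add: power2_eq_square sum_product)
qed

abbreviation density_law :: "(real ^ 'd::finite \<Rightarrow> real) \<Rightarrow> (real ^ 'd) measure" where
  "density_law g \<equiv> density cube_measure (\<lambda>x. ennreal (g x))"

lemma cube_AE_nonneg:
  assumes "g \<in> monotone_densities"
  shows "AE x in cube_measure. 0 \<le> g x"
  using monotone_densitiesD(1)[OF assms] by (intro AE_I2) auto

lemma prob_space_density_law:
  assumes g: "g \<in> monotone_densities"
  shows "prob_space (density_law g)"
proof
  have [measurable]: "g \<in> borel_measurable cube_measure"
    using monotone_densitiesD(2)[OF g] by auto
  have "emeasure (density_law g) (space (density_law g)) = (\<integral>\<^sup>+x. ennreal (g x) \<partial>cube_measure)"
    by (subst emeasure_density) (auto intro!: nn_integral_cong simp: indicator_def)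
  also have "\<dots> = 1"
    using monotone_densitiesD(2,3)[OF g] cube_AE_nonneg[OF g] by (subst nn_integral_eq_integral) auto
  finally show "emeasure (density_law g) (space (density_law g)) = 1" .
qed

lemma prob_space_data_law:
  assumes "g \<in> monotone_densities"
  shows "prob_space (data_law g n)"
  unfolding data_law_def by (intro prob_space_PiM prob_space_density_law assms)

lemma cell_count_mean_square_error:
  fixes g :: "real ^ 'd::finite \<Rightarrow> real"
  assumes g: "g \<in> monotone_densities" and J: "1 \<le> J" and j: "j \<in> grid J"
  shows "(\<integral>\<^sup>+X. ennreal ((cell_count J n X j - real n * cell_prob g J j)\<^sup>2) \<partial>data_law g n)
    \<le> ennreal (real n * cell_prob g J j)"
proof -
  let ?p = "cell_prob g J j" and ?I = "indicator (cell J j) :: real ^ 'd \<Rightarrow> real"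
  interpret prob_space "density_law g"
    by (rule prob_space_density_law[OF g])
  have [measurable]: "g \<in> borel_measurable cube_measure" "cell J j \<in> sets cube_measure"
    using monotone_densitiesD(2)[OF g] J j by auto
  have I_int: "integrable (density_law g) ?I"
    by (intro integrable_const_bound[of _ 1]) auto
  have I_exp: "expectation ?I = ?p"
    unfolding cell_prob_def using cube_AE_nonneg[OF g]
    by (subst integral_density) auto
  have prob_cube: "prob unit_cube = 1"
    using prob_space by simp
  \<comment> \<open>Since indicators are idempotent, the square is affine in the indicator.\<close>
  have sq: "(?I x - ?p)\<^sup>2 = (1 - 2 * ?p) * ?I x + ?p\<^sup>2" for x
    by (auto simp: indicator_def power2_diff power2_eq_square algebra_simps)
  have var: "expectation (\<lambda>x. (?I x - ?p)\<^sup>2) = ?p - ?p\<^sup>2"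
    unfolding sq using I_int I_exp by (simp add: prob_cube power2_eq_square algebra_simps)
  have sum: "cell_count J n X j - real n * ?p = (\<Sum>i<n. ?I (X i) - ?p)" for X
    by (simp add: cell_count_def sum_subtractf)
  have "has_bochner_integral (data_law g n) (\<lambda>X. (cell_count J n X j - real n * ?p)\<^sup>2)
      (real n * expectation (\<lambda>x. (?I x - ?p)\<^sup>2))"
    unfolding sum data_law_def using I_int I_exp
    by (intro expectation_square_sum_PiM) (auto simp: sq prob_cube)
  then have "(\<integral>\<^sup>+X. ennreal ((cell_count J n X j - real n * ?p)\<^sup>2) \<partial>data_law g n)
      = ennreal (real n * (?p - ?p\<^sup>2))"
    unfolding var by (subst nn_integral_eq_integral) (auto simp: has_bochner_integral_iff)
  also have "\<dots> \<le> ennreal (real n * ?p)"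
    by (intro ennreal_leI mult_left_mono) auto
  finally show ?thesis .
qed

text \<open>
  Almost surely no observation falls on the null set that the cells leave out.
\<close>

lemma AE_sum_cell_count:
  fixes g :: "real ^ 'd::finite \<Rightarrow> real"
  assumes g: "g \<in> monotone_densities" and J: "1 \<le> J"
  shows "AE X in data_law g n. (\<Sum>j\<in>grid J. cell_count J n X j) = real n"
proof -
  have [measurable]: "g \<in> borel_measurable cube_measure"
    using monotone_densitiesD(2)[OF g] by auto
  have one: "AE x in density_law g. \<exists>j\<in>grid J. x \<in> cell J j"
    using AE_in_cell[OF J] by (subst AE_density) auto
  have "AE X in data_law g n. \<forall>i\<in>{..<n}. \<exists>j\<in>grid J. X i \<in> cell J j"
  proof (rule AE_finite_allI)
    fix i assume "i \<in> {..<n}"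
    then show "AE X in data_law g n. \<exists>j\<in>grid J. X i \<in> cell J j"
      unfolding data_law_def
      by (intro AE_PiM_component[where P = "\<lambda>x. \<exists>j\<in>grid J. x \<in> cell J j"] prob_space_density_law g one)
  qed simp
  then show ?thesis
  proof eventually_elim
    case (elim X)
    have "(\<Sum>j\<in>grid J. cell_count J n X j) = (\<Sum>i<n. \<Sum>j\<in>grid J. 1 * indicator (cell J j) (X i))"
      unfolding cell_count_def by (subst sum.swap) simp
    also have "\<dots> = (\<Sum>i<n. 1)"
    proof (rule sum.cong[OF refl])
      fix i assume "i \<in> {..<n}"
      with elim obtain j where "j \<in> grid J" "X i \<in> cell J j" by blast
      then show "(\<Sum>j\<in>grid J. 1 * indicator (cell J j) (X i)) = (1 :: real)"
        by (rule sum_cell_indicator[OF J])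
    qed
    finally show ?case by simp
  qed
qed

lemma cell_count_nonneg: "0 \<le> cell_count J n X j"
  by (auto simp: cell_count_def intro!: sum_nonneg)

section \<open>Posterior risk and contraction\<close>

text \<open>
  Writing \<open>A = sum \<alpha> I\<close>, the bias of the posterior mean is
  \<open>((N i - n * p i) + (\<alpha> i - A * p i)) / S\<close>. The part caused by the prior satisfies
  \<open>(\<alpha> i - A * p i)\<^sup>2 \<le> a * \<alpha> i + a * B * (A * p i)\<close>, which sums to \<open>a * (1 + B) * A\<close>. Since \<open>A \<le> S\<close>, it
  contributes only order \<open>1 / S\<close> however large \<open>I\<close> is.
\<close>

lemma dirichlet_risk_sum_le:
  fixes \<alpha> N p :: "'i \<Rightarrow> real"
  assumes I: "finite I"
    and \<alpha>: "\<And>i. i \<in> I \<Longrightarrow> 0 \<le> \<alpha> i" "\<And>i. i \<in> I \<Longrightarrow> \<alpha> i \<le> a"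
    and p: "\<And>i. i \<in> I \<Longrightarrow> 0 \<le> p i" "\<And>i. i \<in> I \<Longrightarrow> real (card I) * p i \<le> B" "sum p I = 1"
    and N: "sum N I = n" "0 < n" and "0 \<le> a" "0 \<le> B"
  defines "S \<equiv> \<Sum>i\<in>I. \<alpha> i + N i"
  shows "(\<Sum>i\<in>I. ((\<alpha> i + N i) / S - p i)\<^sup>2 + (\<alpha> i + N i) / S\<^sup>2)
    \<le> 2 / n\<^sup>2 * (\<Sum>i\<in>I. (N i - n * p i)\<^sup>2) + (1 + 2 * a * (1 + B)) / n"
proof -
  let ?A = "sum \<alpha> I"
  have S: "S = ?A + n"
    using N by (simp add: S_def sum.distrib)
  have A: "0 \<le> ?A" "?A \<le> real (card I) * a"
    using \<alpha> by (auto intro!: sum_nonneg sum_bounded_above)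
  have Sn: "0 < S" "n \<le> S" "?A \<le> S" using S A N by auto
  have bias: "((\<alpha> i + N i) / S - p i)\<^sup>2
      \<le> 2 / n\<^sup>2 * (N i - n * p i)\<^sup>2 + 2 * (a * \<alpha> i + a * B * (?A * p i)) / S\<^sup>2" if i: "i \<in> I" for i
  proof -
    \<comment> \<open>Both factors of the size of \<open>I\<close> cancel: \<open>A\<close> grows at most like it and \<open>p i\<close> decays like its inverse.\<close>
    have "?A * p i \<le> real (card I) * a * p i"
      using A p(1)[OF i] by (intro mult_right_mono)
    also have "\<dots> \<le> a * B"
      using mult_left_mono[OF p(2)[OF i] \<open>0 \<le> a\<close>] by (simp add: mult_ac)
    finally have Ap: "?A * p i \<le> a * B" .
    have "(\<alpha> i - ?A * p i)\<^sup>2 \<le> (\<alpha> i)\<^sup>2 + (?A * p i)\<^sup>2"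
      using A(1) p(1)[OF i] \<alpha>(1)[OF i] by (simp add: power2_diff)
    also have "\<dots> \<le> a * \<alpha> i + a * B * (?A * p i)"
      unfolding power2_eq_square using A(1) p(1)[OF i] \<alpha>[OF i] Ap
      by (intro add_mono mult_right_mono) auto
    finally have prior: "(\<alpha> i - ?A * p i)\<^sup>2 \<le> a * \<alpha> i + a * B * (?A * p i)" .
    have "(\<alpha> i + N i) / S - p i = ((N i - n * p i) + (\<alpha> i - ?A * p i)) / S"
      using Sn(1) by (simp add: S field_simps)
    then have "((\<alpha> i + N i) / S - p i)\<^sup>2 = ((N i - n * p i) + (\<alpha> i - ?A * p i))\<^sup>2 / S\<^sup>2"
      by (simp add: power_divide)
    also have "\<dots> \<le> (2 * (N i - n * p i)\<^sup>2 + 2 * (\<alpha> i - ?A * p i)\<^sup>2) / S\<^sup>2"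
    proof (rule divide_right_mono)
      have "(u + v)\<^sup>2 \<le> 2 * u\<^sup>2 + 2 * v\<^sup>2" for u v :: real
        using zero_le_power2[of "u - v"] unfolding power2_sum power2_diff by linarith
      then show "((N i - n * p i) + (\<alpha> i - ?A * p i))\<^sup>2
          \<le> 2 * (N i - n * p i)\<^sup>2 + 2 * (\<alpha> i - ?A * p i)\<^sup>2" .
    qed simp
    also have "\<dots> = 2 * (N i - n * p i)\<^sup>2 / S\<^sup>2 + 2 * (\<alpha> i - ?A * p i)\<^sup>2 / S\<^sup>2"
      by (rule add_divide_distrib)
    also have "\<dots> \<le> 2 * (N i - n * p i)\<^sup>2 / n\<^sup>2 + 2 * (a * \<alpha> i + a * B * (?A * p i)) / S\<^sup>2"
      using prior Sn N by (intro add_mono divide_left_mono divide_right_mono power_mono mult_pos_pos) auto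
    finally show ?thesis by simp
  qed
  have "(\<Sum>i\<in>I. ((\<alpha> i + N i) / S - p i)\<^sup>2 + (\<alpha> i + N i) / S\<^sup>2)
      \<le> (\<Sum>i\<in>I. 2 / n\<^sup>2 * (N i - n * p i)\<^sup>2 + 2 * (a * \<alpha> i + a * B * (?A * p i)) / S\<^sup>2 + (\<alpha> i + N i) / S\<^sup>2)"
    by (intro sum_mono add_right_mono bias)
  also have "\<dots> = 2 / n\<^sup>2 * (\<Sum>i\<in>I. (N i - n * p i)\<^sup>2)
      + 2 * (a * ?A + a * B * (?A * sum p I)) / S\<^sup>2 + S / S\<^sup>2"
    by (simp only: S_def sum.distrib sum_divide_distrib[symmetric] sum_distrib_left[symmetric])
  also have "\<dots> = 2 / n\<^sup>2 * (\<Sum>i\<in>I. (N i - n * p i)\<^sup>2) + (2 * a * (1 + B) * (?A / S) + 1) / S"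
    using Sn(1) p(3) by (simp add: power2_eq_square field_simps)
  also have "\<dots> \<le> 2 / n\<^sup>2 * (\<Sum>i\<in>I. (N i - n * p i)\<^sup>2) + (2 * a * (1 + B) * 1 + 1) / n"
    using Sn A N \<open>0 \<le> a\<close> \<open>0 \<le> B\<close>
    by (intro add_left_mono frac_le add_right_mono mult_left_mono add_nonneg_nonneg) auto
  finally show ?thesis by (simp add: add.commute)
qed

lemma AE_posterior_mean_square_error:
  fixes g :: "real ^ 'd::finite \<Rightarrow> real" and \<alpha> :: "nat ^ 'd \<Rightarrow> real"
  assumes g: "g \<in> monotone_densities" and J: "1 \<le> J" and n: "1 \<le> n"
    and \<alpha>: "\<And>j. j \<in> grid J \<Longrightarrow> 0 < \<alpha> j" "\<And>j. j \<in> grid J \<Longrightarrow> \<alpha> j \<le> a"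
  shows "AE X in data_law g n.
    (\<integral>\<^sup>+\<theta>. ennreal (\<Sum>j\<in>grid J. (\<theta> j - cell_prob g J j)\<^sup>2) \<partial>posterior J \<alpha> n X)
    \<le> ennreal (2 / (real n)\<^sup>2 * (\<Sum>j\<in>grid J. (cell_count J n X j - real n * cell_prob g J j)\<^sup>2)
        + (1 + 2 * a * (1 + g 0)) / real n)"
  using AE_sum_cell_count[OF g J, of n]
proof eventually_elim
  case X: (elim X)
  let ?G = "grid J :: (nat ^ 'd) set" and ?p = "cell_prob g J" and ?N = "cell_count J n"
  let ?q = "1 + 2 * a * (1 + g 0)"
  have g0: "0 \<le> g 0"
    by (intro monotone_densitiesD(1)[OF g]) (simp add: mem_box_cart)
  have a: "0 < a"
    using \<alpha>[OF one_in_grid[OF J]] by linarith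
  let ?\<beta> = "\<lambda>j. \<alpha> j + ?N X j"
  have \<beta>: "0 < ?\<beta> j" if "j \<in> ?G" for j
    using \<alpha>(1)[OF that] cell_count_nonneg[of J n X j] by linarith
  have "(\<integral>\<^sup>+\<theta>. ennreal (\<Sum>j\<in>?G. (\<theta> j - ?p j)\<^sup>2) \<partial>posterior J \<alpha> n X)
      = (\<integral>\<^sup>+\<theta>. (\<Sum>j\<in>?G. ennreal ((\<theta> j - ?p j)\<^sup>2)) \<partial>dirichlet ?G ?\<beta>)"
    unfolding posterior_def by (subst sum_ennreal) auto
  also have "\<dots> = (\<Sum>j\<in>?G. \<integral>\<^sup>+\<theta>. ennreal ((\<theta> j - ?p j)\<^sup>2) \<partial>dirichlet ?G ?\<beta>)"
    by (intro nn_integral_sum) measurable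
  also have "\<dots> \<le> (\<Sum>j\<in>?G. ennreal ((?\<beta> j / sum ?\<beta> ?G - ?p j)\<^sup>2 + ?\<beta> j / (sum ?\<beta> ?G)\<^sup>2))"
    by (intro sum_mono dirichlet_mean_square_error \<beta> finite_grid)
  also have "\<dots> = ennreal (\<Sum>j\<in>?G. (?\<beta> j / sum ?\<beta> ?G - ?p j)\<^sup>2 + ?\<beta> j / (sum ?\<beta> ?G)\<^sup>2)"
    by (intro sum_ennreal add_nonneg_nonneg divide_nonneg_nonneg zero_le_power2 less_imp_le[OF \<beta>])
  also have "\<dots> \<le> ennreal (2 / (real n)\<^sup>2 * (\<Sum>j\<in>?G. (?N X j - real n * ?p j)\<^sup>2) + ?q / real n)"
  proof (intro ennreal_leI dirichlet_risk_sum_le finite_grid X)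
    fix j :: "nat ^ 'd" assume j: "j \<in> ?G"
    show "real (card ?G) * ?p j \<le> g 0"
      using mult_left_mono[OF cell_prob_le[OF g J j], of "real J ^ CARD('d)"] J by (simp add: card_grid)
    show "0 \<le> \<alpha> j" using \<alpha>(1)[OF j] by simp
  qed (use \<alpha> a g0 n sum_cell_prob[OF g J] cell_prob_nonneg[OF g] in auto)
  finally show ?case .
qed

lemma cell_count_borel_measurable:
  fixes g :: "real ^ 'd::finite \<Rightarrow> real"
  assumes "1 \<le> J" "j \<in> grid J"
  shows "(\<lambda>X. cell_count J n X j) \<in> borel_measurable (data_law g n)"
proof -
  have [measurable]: "(indicator (cell J j) :: real ^ 'd \<Rightarrow> real) \<in> borel_measurable (density_law g)"
    using assms by simp
  show ?thesis
    unfolding cell_count_def data_law_def by measurable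
qed

lemma expected_squared_count_error:
  fixes g :: "real ^ 'd::finite \<Rightarrow> real"
  assumes g: "g \<in> monotone_densities" and J: "1 \<le> J" and n: "1 \<le> n" and q: "0 \<le> q"
  shows "(\<integral>\<^sup>+X. ennreal (2 / (real n)\<^sup>2 * (\<Sum>j\<in>grid J. (cell_count J n X j - real n * cell_prob g J j)\<^sup>2)
      + q / real n) \<partial>data_law g n) \<le> ennreal ((2 + q) / real n)"
proof -
  let ?G = "grid J :: (nat ^ 'd) set"
  let ?e = "\<lambda>j X. (cell_count J n X j - real n * cell_prob g J j)\<^sup>2"
  have meas: "(\<lambda>X. ennreal (?e j X)) \<in> borel_measurable (data_law g n)" if "j \<in> ?G" for j
    using cell_count_borel_measurable[OF J that, of n g] by measurable
  interpret data: prob_space "data_law g n"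
    by (rule prob_space_data_law[OF g])
  have "(\<integral>\<^sup>+X. ennreal (2 / (real n)\<^sup>2 * (\<Sum>j\<in>?G. ?e j X) + q / real n) \<partial>data_law g n)
      = (\<integral>\<^sup>+X. ennreal (2 / (real n)\<^sup>2) * (\<Sum>j\<in>?G. ennreal (?e j X)) + ennreal (q / real n) \<partial>data_law g n)"
    using q by (intro nn_integral_cong) (simp add: ennreal_plus ennreal_mult' sum_nonneg del: times_divide_eq_left)
  also have "\<dots> = ennreal (2 / (real n)\<^sup>2)
      * (\<Sum>j\<in>?G. \<integral>\<^sup>+X. ennreal (?e j X) \<partial>data_law g n) + ennreal (q / real n)"
    using meas by (simp add: nn_integral_add nn_integral_cmult nn_integral_sum data.emeasure_space_1 del: sum_ennreal)
  also have "\<dots> \<le> ennreal (2 / (real n)\<^sup>2) * (\<Sum>j\<in>?G. ennreal (real n * cell_prob g J j)) + ennreal (q / real n)"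
    by (intro add_right_mono mult_left_mono sum_mono cell_count_mean_square_error g J) auto
  also have "(\<Sum>j\<in>?G. ennreal (real n * cell_prob g J j)) = ennreal (real n)"
    using cell_prob_nonneg[OF g, of J] sum_cell_prob[OF g J]
    by (subst sum_ennreal) (auto simp: sum_distrib_left[symmetric])
  also have "ennreal (2 / (real n)\<^sup>2) * ennreal (real n) + ennreal (q / real n)
      = ennreal (2 / (real n)\<^sup>2 * real n + q / real n)"
    using q by (subst ennreal_plus) (auto simp: ennreal_mult'[symmetric])
  also have "2 / (real n)\<^sup>2 * real n + q / real n = (2 + q) / real n"
    using n by (simp add: power2_eq_square field_simps)
  finally show ?thesis .
qed

text \<open>
  Since \<open>r\<close> is at least twice the approximation error \<open>6 * d * g0 0 / J\<close>, a distance above \<open>r\<close> forces \<open>\<Sum>j. \<bar>\<theta> j - p j\<bar>\<close> above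
  \<open>r / 8\<close>, hence by Cauchy-Schwarz \<open>\<Sum>j. (\<theta> j - p j)\<^sup>2\<close> above \<open>r\<^sup>2 / (64 * J ^ d)\<close>. The latter event is
  measurable and Markov's inequality applies to it, so it controls the outer measure of the former.
\<close>

lemma immersion_posterior_le:
  fixes g0 :: "real ^ 'd::finite \<Rightarrow> real" and \<alpha> :: "nat ^ 'd \<Rightarrow> real"
  assumes g0: "g0 \<in> monotone_densities" and h: "h \<in> monotone_densities" and J: "1 \<le> J"
    and T: "\<And>\<theta>. is_l1_projection J \<theta> (T \<theta>)"
    and r: "0 < r" "12 * real CARD('d) * g0 0 / real J \<le> r"
  shows "immersion_posterior J \<alpha> T h n X {g. l1_dist g g0 > r}
    \<le> ennreal (64 * real J ^ CARD('d) / r\<^sup>2)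
      * (\<integral>\<^sup>+\<theta>. ennreal (\<Sum>j\<in>grid J. (\<theta> j - cell_prob g0 J j)\<^sup>2) \<partial>posterior J \<alpha> n X)"
proof -
  let ?G = "grid J :: (nat ^ 'd) set" and ?p = "cell_prob g0 J"
  let ?Q = "posterior J \<alpha> n X" and ?u = "\<lambda>\<theta>. ennreal (\<Sum>j\<in>grid J. (\<theta> j - cell_prob g0 J j)\<^sup>2)"
  let ?c = "ennreal (64 * real J ^ CARD('d) / r\<^sup>2)"
  let ?A = "{\<theta> \<in> space ?Q. immersion J T h \<theta> \<in> {g. l1_dist g g0 > r}}"
  let ?E = "{\<theta> \<in> space ?Q. 1 \<le> ?c * ?u \<theta>}" and ?N = "{\<theta> \<in> space ?Q. \<not> (\<forall>j\<in>?G. 0 < \<theta> j)}"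
  have [measurable_cong]: "sets ?Q = sets (\<Pi>\<^sub>M j\<in>?G. borel)"
    by (simp add: posterior_def sets_dirichlet)
  have [measurable]: "Measurable.pred ?Q (\<lambda>\<theta>. \<forall>j\<in>?G. 0 < \<theta> j)"
    by (intro pred_intros_finite finite_grid) measurable
  have u [measurable]: "?u \<in> borel_measurable ?Q"
    by measurable
  have N: "?N \<in> sets ?Q" "emeasure ?Q ?N = 0"
    using AE_dirichlet_positive[OF finite_grid, of J "\<lambda>j. \<alpha> j + cell_count J n X j"]
    by (auto simp: posterior_def[symmetric] AE_iff_measurable[OF _ refl])
  \<comment> \<open>The deterministic bound needs nonnegative weights, which is guaranteed outside the null set \<open>?N\<close>.\<close>
  have "?A \<subseteq> ?E \<union> ?N"
  proof
    fix \<theta> assume A: "\<theta> \<in> ?A"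
    show "\<theta> \<in> ?E \<union> ?N"
    proof (cases "\<forall>j\<in>?G. 0 < \<theta> j")
      case True
      let ?S = "\<Sum>j\<in>?G. \<bar>\<theta> j - ?p j\<bar>"
      have "r < 4 * ?S + 6 * real CARD('d) * g0 0 / real J"
        using A l1_dist_immersion_le[where T = T, OF g0 h J T, of \<theta>] True by (auto simp: less_imp_le)
      then have "r / 8 < ?S" using r by simp
      then have "(r / 8)\<^sup>2 \<le> ?S\<^sup>2" using r by (intro power_mono) auto
      also have "\<dots> \<le> (\<Sum>j\<in>?G. (\<theta> j - ?p j)\<^sup>2) * real J ^ CARD('d)"
        using Cauchy_Schwarz_ineq_sum[of "\<lambda>j. \<bar>\<theta> j - ?p j\<bar>" "\<lambda>_. 1" ?G] by (simp add: card_grid)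
      finally have "1 \<le> 64 * real J ^ CARD('d) / r\<^sup>2 * (\<Sum>j\<in>?G. (\<theta> j - ?p j)\<^sup>2)"
        using r by (simp add: power_divide field_simps)
      then have "1 \<le> ?c * ?u \<theta>"
        by (simp add: ennreal_mult'[symmetric])
      then show ?thesis using A by simp
    qed (use A in auto)
  qed
  then have "outer_measure_of ?Q ?A \<le> emeasure ?Q (?E \<union> ?N)"
    using N outer_measure_of_mono[of ?A "?E \<union> ?N" ?Q] by simp
  also have "\<dots> = emeasure ?Q ?E"
    using N by (intro emeasure_Un_null_set) auto
  also have "\<dots> \<le> ?c * (\<integral>\<^sup>+\<theta>. ?u \<theta> * indicator (space ?Q) \<theta> \<partial>?Q)"
    by (intro nn_integral_Markov_inequality) auto
  also have "(\<integral>\<^sup>+\<theta>. ?u \<theta> * indicator (space ?Q) \<theta> \<partial>?Q) = (\<integral>\<^sup>+\<theta>. ?u \<theta> \<partial>?Q)"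
    by (intro nn_integral_cong) auto
  finally show ?thesis
    by (simp add: immersion_posterior_def)
qed

text \<open>
  The integrand is first bounded by a polynomial in the cell counts. This majorant is measurable in the
  data, so its integral is linear and reduces to the variances of the counts.
\<close>

lemma expected_immersion_posterior_le:
  fixes g0 :: "real ^ 'd::finite \<Rightarrow> real" and \<alpha> :: "nat ^ 'd \<Rightarrow> real"
  assumes g0: "g0 \<in> monotone_densities" and h: "h \<in> monotone_densities"
    and J: "1 \<le> J" and n: "1 \<le> n"
    and \<alpha>: "\<And>j. j \<in> grid J \<Longrightarrow> 0 < \<alpha> j" "\<And>j. j \<in> grid J \<Longrightarrow> \<alpha> j \<le> a"
    and T: "\<And>\<theta>. is_l1_projection J \<theta> (T \<theta>)"
    and M: "0 < M" "12 * real CARD('d) * g0 0 \<le> M"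
    and \<epsilon>: "1 / real J \<le> \<epsilon>" "real J ^ CARD('d) / real n \<le> \<epsilon>\<^sup>2"
  shows "(\<integral>\<^sup>+X. immersion_posterior J \<alpha> T h n X {g. l1_dist g g0 > M * \<epsilon>} \<partial>data_law g0 n)
    \<le> ennreal (64 * (3 + 2 * a * (1 + g0 0)) / M\<^sup>2)"
proof -
  let ?q = "1 + 2 * a * (1 + g0 0)"
  let ?R = "\<lambda>X. ennreal (2 / (real n)\<^sup>2 * (\<Sum>j\<in>grid J. (cell_count J n X j - real n * cell_prob g0 J j)\<^sup>2)
    + ?q / real n)"
  define C where "C = 3 + 2 * a * (1 + g0 0)"
  let ?c = "64 * real J ^ CARD('d) / (M * \<epsilon>)\<^sup>2"
  have g00: "0 \<le> g0 0"
    by (intro monotone_densitiesD(1)[OF g0]) (simp add: mem_box_cart)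
  have a: "0 < a"
    using \<alpha>[OF one_in_grid[OF J]] by linarith
  have C: "0 \<le> C"
    using a g00 by (simp add: C_def)
  have eps: "0 < \<epsilon>"
    using \<epsilon>(1) J by (auto intro: less_le_trans[rotated])
  have "12 * real CARD('d) * g0 0 / real J \<le> M * \<epsilon>"
    using mult_mono[OF M(2) \<epsilon>(1)] M by simp
  then have bound: "immersion_posterior J \<alpha> T h n X {g. l1_dist g g0 > M * \<epsilon>} \<le> ennreal ?c
      * (\<integral>\<^sup>+\<theta>. ennreal (\<Sum>j\<in>grid J. (\<theta> j - cell_prob g0 J j)\<^sup>2) \<partial>posterior J \<alpha> n X)" for X
    using M eps by (intro immersion_posterior_le g0 h J T) auto
  have [measurable]: "?R \<in> borel_measurable (data_law g0 n)"
    using cell_count_borel_measurable[OF J, of _ n g0] by measurable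
  have "(\<integral>\<^sup>+X. immersion_posterior J \<alpha> T h n X {g. l1_dist g g0 > M * \<epsilon>} \<partial>data_law g0 n)
      \<le> (\<integral>\<^sup>+X. ennreal ?c * ?R X \<partial>data_law g0 n)"
  proof (rule nn_integral_mono_AE)
    have "AE X in data_law g0 n.
        (\<integral>\<^sup>+\<theta>. ennreal (\<Sum>j\<in>grid J. (\<theta> j - cell_prob g0 J j)\<^sup>2) \<partial>posterior J \<alpha> n X) \<le> ?R X"
      by (intro AE_posterior_mean_square_error g0 J n \<alpha>)
    then show "AE X in data_law g0 n.
        immersion_posterior J \<alpha> T h n X {g. l1_dist g g0 > M * \<epsilon>} \<le> ennreal ?c * ?R X"
      by eventually_elim (rule order_trans[OF bound mult_left_mono], auto)
  qed
  also have "\<dots> = ennreal ?c * (\<integral>\<^sup>+X. ?R X \<partial>data_law g0 n)"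
    by (rule nn_integral_cmult) measurable
  also have "\<dots> \<le> ennreal ?c * ennreal ((2 + ?q) / real n)"
    using a g00 by (intro mult_left_mono expected_squared_count_error g0 J n) auto
  also have "2 + ?q = C" by (simp add: C_def)
  also have "ennreal ?c * ennreal (C / real n)
      = ennreal (64 * C / M\<^sup>2 * (real J ^ CARD('d) / real n / \<epsilon>\<^sup>2))"
    using C by (simp add: ennreal_mult[symmetric] power_mult_distrib mult_ac)
  also have "\<dots> \<le> ennreal (64 * C / M\<^sup>2 * 1)"
  proof (intro ennreal_leI mult_left_mono)
    show "real J ^ CARD('d) / real n / \<epsilon>\<^sup>2 \<le> 1"
      using \<epsilon>(2) eps by (subst divide_le_eq_1_pos) auto
  qed (use C in auto)
  finally show ?thesis by (simp add: C_def)
qed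

section \<open>Dependence of the rate on the number of cells\<close>

text \<open>
  With \<open>m\<close> the maximum on the right, \<open>1 / n = (1 / J) ^ d * (J ^ d / n) \<le> m ^ d * m\<^sup>2\<close>.
\<close>

lemma root_rate_le:
  assumes J: "1 \<le> (J::nat)" and n: "1 \<le> (n::nat)"
  shows "real n powr (- 1 / (2 + real d)) \<le> max (1 / real J) (sqrt (real J ^ d / real n))"
proof -
  let ?m = "max (1 / real J) (sqrt (real J ^ d / real n))"
  have m: "0 < ?m" using J by (simp add: less_max_iff_disj)
  have "1 / real n = (1 / real J) ^ d * (sqrt (real J ^ d / real n))\<^sup>2"
    using J by (simp add: power_divide)
  also have "\<dots> \<le> ?m ^ d * ?m\<^sup>2"
    using J m by (intro mult_mono power_mono) (auto intro!: zero_le_power less_imp_le)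
  also have "\<dots> = ?m powr (2 + real d)"
    using m by (simp add: powr_add powr_realpow)
  finally have "(1 / real n) powr (1 / (2 + real d)) \<le> (?m powr (2 + real d)) powr (1 / (2 + real d))"
    by (intro powr_mono2) auto
  also have "\<dots> = ?m"
    using m by (simp add: powr_powr)
  finally show ?thesis
    using n by (simp add: powr_divide powr_minus_divide)
qed

lemma optimal_rate_bigo_rate:
  assumes "\<And>n. 1 \<le> J n"
  shows "(\<lambda>n. real n powr (- 1 / (2 + real d))) \<in> O(rate d J)"
proof (intro landau_o.big_mono eventually_mono[OF eventually_ge_at_top[of 1]])
  fix n :: nat assume n: "1 \<le> n"
  have "norm (real n powr (- 1 / (2 + real d))) = real n powr (- 1 / (2 + real d))"
    by simp
  also have "\<dots> \<le> rate d J n"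
    unfolding rate_def by (rule root_rate_le[OF assms n])
  finally show "norm (real n powr (- 1 / (2 + real d))) \<le> norm (rate d J n)"
    by simp
qed

text \<open>
  Both error terms are powers of \<open>n\<close> up to constants, and the chosen exponent of \<open>J\<close> makes the two exponents
  equal.
\<close>

lemma bins_of_optimal_order:
  assumes J: "\<And>n. 1 \<le> J n" and d: "1 \<le> d"
    and J_theta: "(\<lambda>n. real (J n)) \<in> \<Theta>(\<lambda>n. real n powr (1 / (2 + real d)))"
  shows "admissible_bins d J" and "rate d J \<in> \<Theta>(\<lambda>n. real n powr (- 1 / (2 + real d)))"
proof -
  let ?s = "1 / (2 + real d)"
  have abs_J: "\<bar>real (J n)\<bar> = real (J n)" and Jpos: "0 < real (J n)" for n
    using J[of n] by simp_all
  have powr_theta: "(\<lambda>n. real (J n) powr p) \<in> \<Theta>(\<lambda>n. real n powr (?s * p))" for p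
    using bigtheta_powr[OF J_theta, of p] by (simp add: powr_powr)
  have Jpow: "real (J n) ^ d = real (J n) powr real d" for n
    using Jpos by (simp add: powr_realpow)
  have decay: "f \<longlonglongrightarrow> 0" if "f \<in> \<Theta>(\<lambda>n. real n powr q)" "q < 0" for f :: "nat \<Rightarrow> real" and q
  proof -
    have "(\<lambda>n. real n powr q) \<longlonglongrightarrow> 0"
      using that(2) by (intro tendsto_neg_powr filterlim_real_sequentially)
    then have "(\<lambda>n. real n powr q) \<in> o(\<lambda>_. 1)"
      by (intro smalloI_tendsto) auto
    with that(1) have "f \<in> o(\<lambda>_. 1)"
      by (rule landau_o.big_small_trans[OF bigthetaD1])
    then show ?thesis
      using smalloD_tendsto by fastforce
  qed
  have inv: "(\<lambda>n. 1 / real (J n)) \<in> \<Theta>(\<lambda>n. real n powr (- 1 / (2 + real d)))"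
    using powr_theta[of "- 1"] Jpos by (simp add: powr_minus_divide)
  have inv_pow: "(\<lambda>n. 1 / real (J n) ^ d) \<in> \<Theta>(\<lambda>n. real n powr (- real d / (2 + real d)))"
    using powr_theta[of "- real d"] by (simp add: Jpow powr_minus_divide)
  have ratio: "(\<lambda>n. real (J n) ^ d / real n) \<in> \<Theta>(\<lambda>n. real n powr (- 2 / (2 + real d)))"
  proof -
    have "(\<lambda>n. real (J n) ^ d / real n) \<in> \<Theta>(\<lambda>n. real n powr (?s * real d) / real n)"
      unfolding Jpow by (intro landau_theta.divide powr_theta) auto
    also have "(\<lambda>n. real n powr (?s * real d) / real n) \<in> \<Theta>(\<lambda>n. real n powr (- 2 / (2 + real d)))"
    proof (rule bigthetaI_cong)
      have "?s * real d = - 2 / (2 + real d) + 1"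
        by (simp add: field_simps)
      then show "\<forall>\<^sub>F n in sequentially. real n powr (?s * real d) / real n = real n powr (- 2 / (2 + real d))"
        by (intro eventually_mono[OF eventually_gt_at_top[of 0]]) (simp add: powr_diff powr_minus_divide)
    qed
    finally show ?thesis .
  qed
  show "admissible_bins d J"
    unfolding admissible_bins_def using J d inv_pow ratio by (auto intro!: decay)
  have root: "(\<lambda>n. sqrt (real (J n) ^ d / real n)) \<in> \<Theta>(\<lambda>n. real n powr (- 1 / (2 + real d)))"
  proof -
    have "2 / (4 + real d * 2) = 1 / (2 + real d)"
      by (simp add: field_simps)
    then show ?thesis
      using bigtheta_powr[OF ratio, of "1 / 2"] by (simp add: powr_powr powr_half_sqrt)
  qed
  show "rate d J \<in> \<Theta>(\<lambda>n. real n powr (- 1 / (2 + real d)))"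
  proof (rule bigthetaI)
    have "rate d J \<in> O(\<lambda>n. 1 / real (J n) + sqrt (real (J n) ^ d / real n))"
    proof (intro landau_o.big_mono always_eventually allI)
      fix n
      have "0 \<le> 1 / real (J n)" "0 \<le> sqrt (real (J n) ^ d / real n)" by simp_all
      then show "norm (rate d J n) \<le> norm (1 / real (J n) + sqrt (real (J n) ^ d / real n))"
        unfolding rate_def real_norm_def by linarith
    qed
    also have "(\<lambda>n. 1 / real (J n) + sqrt (real (J n) ^ d / real n)) \<in> O(\<lambda>n. real n powr (- 1 / (2 + real d)))"
      using inv root by (intro sum_in_bigo) auto
    finally show "rate d J \<in> O(\<lambda>n. real n powr (- 1 / (2 + real d)))" .
    show "rate d J \<in> \<Omega>(\<lambda>n. real n powr (- 1 / (2 + real d)))"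
      unfolding bigomega_iff_bigo by (rule optimal_rate_bigo_rate[OF J])
  qed
qed

section \<open>Contraction of the immersion posterior\<close>

theorem theorem3p1:
  fixes g0 :: "real ^ 'd::finite \<Rightarrow> real"
    and J :: "nat \<Rightarrow> nat"
    and \<alpha> :: "nat \<Rightarrow> nat ^ 'd \<Rightarrow> real"
    and a0 a1 :: real
    and T :: "nat \<Rightarrow> (nat ^ 'd \<Rightarrow> real) \<Rightarrow> nat ^ 'd \<Rightarrow> real"
    and h :: "nat \<Rightarrow> real ^ 'd \<Rightarrow> real"
  assumes g0: "g0 \<in> monotone_densities"
    and J: "admissible_bins CARD('d) J"
    and a: "0 < a0" "0 < a1"
    and \<alpha>: "\<And>n j. j \<in> grid (J n) \<Longrightarrow> a0 \<le> \<alpha> n j \<and> \<alpha> n j \<le> a1"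
    and T: "\<And>n \<theta>. is_l1_projection (J n) \<theta> (T n \<theta>)"
    and h: "\<And>n. h n \<in> monotone_densities"
    and h_const: "\<And>n j. j \<in> grid (J n) \<Longrightarrow> h n constant_on cell (J n) j"
  shows "(\<forall>M :: nat \<Rightarrow> real. filterlim M at_top sequentially \<longrightarrow>
            (\<lambda>n. \<integral>\<^sup>+ X. immersion_posterior (J n) (\<alpha> n) (T n) (h n) n X
                        {g. l1_dist g g0 > M n * rate CARD('d) J n} \<partial>data_law g0 n)
              \<longlonglongrightarrow> 0)
       \<and> (\<forall>J' :: nat \<Rightarrow> nat. (\<forall>n. 1 \<le> J' n) \<longrightarrow>
            (\<lambda>n. real (J' n)) \<in> \<Theta>(\<lambda>n. real n powr (1 / (2 + real CARD('d)))) \<longrightarrow>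
              admissible_bins CARD('d) J'
              \<and> rate CARD('d) J' \<in> \<Theta>(\<lambda>n. real n powr (- 1 / (2 + real CARD('d)))))
       \<and> (\<forall>J' :: nat \<Rightarrow> nat. admissible_bins CARD('d) J' \<longrightarrow>
            (\<lambda>n. real n powr (- 1 / (2 + real CARD('d)))) \<in> O(rate CARD('d) J'))"
proof (intro conjI allI impI)
  fix M :: "nat \<Rightarrow> real" assume M: "filterlim M at_top sequentially"
  let ?K = "64 * (3 + 2 * a1 * (1 + g0 0))"
  let ?P = "\<lambda>n. \<integral>\<^sup>+ X. immersion_posterior (J n) (\<alpha> n) (T n) (h n) n X
                        {g. l1_dist g g0 > M n * rate CARD('d) J n} \<partial>data_law g0 n"
  have J1: "1 \<le> J n" for n
    using J by (simp add: admissible_bins_def)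
  have rate_ge: "1 / real (J n) \<le> rate CARD('d) J n"
      "real (J n) ^ CARD('d) / real n \<le> (rate CARD('d) J n)\<^sup>2" for n
  proof -
    show "1 / real (J n) \<le> rate CARD('d) J n"
      by (simp add: rate_def)
    have "(sqrt (real (J n) ^ CARD('d) / real n))\<^sup>2 \<le> (rate CARD('d) J n)\<^sup>2"
      by (intro power_mono) (auto simp: rate_def)
    then show "real (J n) ^ CARD('d) / real n \<le> (rate CARD('d) J n)\<^sup>2"
      by simp
  qed
  have bound: "\<forall>\<^sub>F n in sequentially. ?P n \<le> ennreal (?K / (M n)\<^sup>2)"
  proof -
    have "\<forall>\<^sub>F n in sequentially. 1 \<le> n" "\<forall>\<^sub>F n in sequentially. 0 < M n"
        "\<forall>\<^sub>F n in sequentially. 12 * real CARD('d) * g0 0 \<le> M n"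
      using M eventually_ge_at_top[of 1] filterlim_at_top_dense[of M sequentially]
      by (auto simp: filterlim_at_top)
    then show ?thesis
    proof eventually_elim
      case (elim n)
      have "0 < \<alpha> n j" "\<alpha> n j \<le> a1" if "j \<in> grid (J n)" for j
        using \<alpha>[OF that] a by auto
      then show ?case
        by (intro expected_immersion_posterior_le g0 h J1 T elim rate_ge)
    qed
  qed
  have "(\<lambda>n. ?K / (M n)\<^sup>2) \<longlonglongrightarrow> 0"
    by (intro tendsto_divide_0[OF tendsto_const] filterlim_at_top_imp_at_infinity filterlim_pow_at_top M) simp
  then have "(\<lambda>n. ennreal (?K / (M n)\<^sup>2)) \<longlonglongrightarrow> 0"
    using tendsto_ennrealI by fastforce
  then show "?P \<longlonglongrightarrow> 0"
    by (rule tendsto_sandwich[OF _ bound tendsto_const, rotated]) simp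
next
  fix J' :: "nat \<Rightarrow> nat"
  assume "\<forall>n. 1 \<le> J' n" "(\<lambda>n. real (J' n)) \<in> \<Theta>(\<lambda>n. real n powr (1 / (2 + real CARD('d))))"
  then show "admissible_bins CARD('d) J'"
      "rate CARD('d) J' \<in> \<Theta>(\<lambda>n. real n powr (- 1 / (2 + real CARD('d))))"
    by (intro bins_of_optimal_order; auto simp: Suc_le_eq)+
next
  fix J' :: "nat \<Rightarrow> nat"
  assume "admissible_bins CARD('d) J'"
  then have "1 \<le> J' n" for n
    by (simp add: admissible_bins_def)
  then show "(\<lambda>n. real n powr (- 1 / (2 + real CARD('d)))) \<in> O(rate CARD('d) J')"
    by (rule optimal_rate_bigo_rate)
qed

end
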